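(* Let $\epsilon\in\mathbb{C}$ with $\operatorname{Re}(\epsilon)>B^{p_+p_-}_\epsilon$ and $\operatorname{Re}(\epsilon)\neq0$. Then the $\mathcal{M}(p_+,p_-)$ regularised quantum dimensions are, for $\lambda\in\mathbb{C}$, $1\le r\le p_+$, $1\le s\le p_-$, $n\in\mathbb{Z}$, $$\operatorname{qdim}[\mathcal{F}^\epsilon_{\lambda+\alpha_0/2}]=e^{2\pi\lambda\epsilon}\,\frac{\sin(i\pi\sqrt{2p_+p_-}\,\epsilon)\,\sin(i\pi\sqrt{2p_+p_-}\,\epsilon)}{\sin(i\pi\sqrt{2p_+/p_-}\,\epsilon)\,\sin(i\pi\sqrt{2p_-/p_+}\,\epsilon)},$$ $$\operatorname{qdim}[\mathcal{I}^\epsilon_{r,s;n}]=e^{\sqrt{2p_+p_-}\,\pi n\epsilon}\,\frac{\sin(ir\pi\sqrt{2p_-/p_+}\,\epsilon)\,\sin(is\pi\sqrt{2p_+/p_-}\,\epsilon)}{\sin(i\pi\sqrt{2p_-/p_+}\,\epsilon)\,\sin(i\pi\sqrt{2p_+/p_-}\,\epsilon)}.$$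
   Context: Let $p_+,p_-\ge2$ be coprime integers, $\alpha_+=\sqrt{2p_-/p_+}$, $\alpha_-=-\sqrt{2p_+/p_-}$, $\alpha_0=\alpha_++\alpha_-$, $\alpha=\sqrt{2p_+p_-}$, $\alpha_{r,s;n}=\frac{1-r}{2}\alpha_++\frac{1-s}{2}\alpha_-+\frac n2\alpha$. Put $q=e^{2\pi i\tau}$ (with $q^x:=e^{2\pi i\tau x}$), $\eta$ the Dedekind eta function, $\theta_{a,b}(\tau)=\sum_{k\in\mathbb{Z}}q^{a(k+\frac{b}{2a})^2}$. The singlet vertex operator algebra $\mathcal{M}(p_+,p_-)$ is the intersection of the kernels of two commuting screening operators on the Heisenberg Fock module $\mathcal{F}_0$; its modules include the Fock modules $\mathcal{F}_\lambda$, irreducible submodules $\mathcal{I}_{r,s;n}$ of Fock modules, Virasoro minimal model modules $\mathcal{L}_{r,s}$, and the vacuum module $\mathcal{K}_{1,1;0}$. Only regularised characters enter: Fock: $\mathrm{ch}[\mathcal{F}^\epsilon_\lambda](\tau)=e^{2\pi\epsilon(\lambda-\alpha_0/2)}q^{(\lambda-\alpha_0/2)^2/2}/\eta(\tau)$, with $\mathcal{F}^\epsilon_{r,s;n}:=\mathcal{F}^\epsilon_{\alpha_{r,s;n}}$. Minimal models (not regularised), $1\le r<p_+$, $1\le s<p_-$: $\mathrm{ch}[\mathcal{L}_{r,s}]=\bigl(\theta_{p_+p_-,rp_--sp_+}-\theta_{p_+p_-,rp_-+sp_+}\bigr)/\eta$. For $1\le r<p_+$, $1\le s<p_-$: $\mathrm{ch}[\mathcal{I}^\epsilon_{r,s;n}]=n\,\delta_{n\ge0}\bigl(\delta_{n\text{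 even}}\mathrm{ch}[\mathcal{L}_{r,s}]-\delta_{n\text{ odd}}\mathrm{ch}[\mathcal{L}_{r,p_--s}]\bigr)+\sum_{k\ge0}(k+1)\bigl(\mathrm{ch}[\mathcal{F}^\epsilon_{p_+-r,s;n-2k-1}]+\mathrm{ch}[\mathcal{F}^\epsilon_{r,p_--s;n-2k-3}]-\mathrm{ch}[\mathcal{F}^\epsilon_{r,s;n-2k-2}]-\mathrm{ch}[\mathcal{F}^\epsilon_{p_+-r,p_--s;n-2k-2}]\bigr)$. Border cases: $\mathrm{ch}[\mathcal{I}^\epsilon_{r,p_-;n}]=\sum_{k\ge0}\bigl(\mathrm{ch}[\mathcal{F}^\epsilon_{p_+-r,p_-;n-2k-1}]-\mathrm{ch}[\mathcal{F}^\epsilon_{r,p_-;n-2k-2}]\bigr)$ for $1\le r<p_+$; $\mathrm{ch}[\mathcal{I}^\epsilon_{p_+,s;n}]=\sum_{k\ge0}\bigl(\mathrm{ch}[\mathcal{F}^\epsilon_{p_+,s;n-2k}]-\mathrm{ch}[\mathcal{F}^\epsilon_{p_+,p_--s;n-2k-1}]\bigr)$ for $1\le s<p_-$; $\mathrm{ch}[\mathcal{I}^\epsilon_{p_+,p_-;n}]=\mathrm{ch}[\mathcal{F}^\epsilon_{p_+,p_-;n}]$. Vacuum: $\mathrm{ch}[\mathcal{K}^\epsilon_{1,1;0}]=\mathrm{ch}[\mathcal{L}_{1,1}]+\mathrm{ch}[\mathcal{I}^\epsilon_{1,1;0}]$. Regularised quantum dimension: $\operatorname{qdim}[M^\epsilon]=\lim_{y\to0^+}\mathrm{ch}[M^\epsilon](iy)/\mathrm{ch}[\mathcal{K}^\epsilon_{1,1;0}](iy)$.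 $B_\epsilon^{p_+p_-}=-\min\{|\frac{m}{\sqrt{2p_+p_-}}-\operatorname{Im}(\epsilon)|:m\in\mathbb{Z}\setminus p_+p_-\mathbb{Z}\}$. *)

theory Defs
  imports "HOL-Analysis.Analysis"
begin

definition qpow :: "complex \<Rightarrow> complex \<Rightarrow> complex" where
  "qpow \<tau> x = exp (2 * of_real pi * \<i> * \<tau> * x)"

definition dedekind_eta :: "complex \<Rightarrow> complex" where
  "dedekind_eta \<tau> = qpow \<tau> (1 / 24) * (\<Prod>n. 1 - qpow \<tau> (of_nat (Suc n)))"

definition theta :: "int \<Rightarrow> int \<Rightarrow> complex \<Rightarrow> complex" where
  "theta a b \<tau> =
     (\<Sum>\<^sub>\<infinity>k\<in>(UNIV :: int set). qpow \<tau> (of_int a * (of_int k + of_int b / (2 * of_int a))\<^sup>2))"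

text \<open>The first two arguments \<open>pp\<close>, \<open>pm\<close> are $p_+$ and $p_-$ throughout.\<close>

definition alpha_plus :: "int \<Rightarrow> int \<Rightarrow> real" where
  "alpha_plus pp pm = sqrt (2 * of_int pm / of_int pp)"

definition alpha_minus :: "int \<Rightarrow> int \<Rightarrow> real" where
  "alpha_minus pp pm = - sqrt (2 * of_int pp / of_int pm)"

definition alpha_zero :: "int \<Rightarrow> int \<Rightarrow> real" where
  "alpha_zero pp pm = alpha_plus pp pm + alpha_minus pp pm"

definition alpha_full :: "int \<Rightarrow> int \<Rightarrow> real" where
  "alpha_full pp pm = sqrt (2 * of_int pp * of_int pm)"

definition alpha_weight :: "int \<Rightarrow> int \<Rightarrow> int \<Rightarrow> int \<Rightarrow> int \<Rightarrow> real" where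
  "alpha_weight pp pm r s n =
     (1 - of_int r) / 2 * alpha_plus pp pm + (1 - of_int s) / 2 * alpha_minus pp pm
       + of_int n / 2 * alpha_full pp pm"

definition ch_fock :: "int \<Rightarrow> int \<Rightarrow> complex \<Rightarrow> complex \<Rightarrow> complex \<Rightarrow> complex" where
  "ch_fock pp pm \<epsilon> lam \<tau> =
     exp (2 * of_real pi * \<epsilon> * (lam - of_real (alpha_zero pp pm) / 2))
       * qpow \<tau> ((lam - of_real (alpha_zero pp pm) / 2)\<^sup>2 / 2) / dedekind_eta \<tau>"

definition ch_fock_rsn ::
  "int \<Rightarrow> int \<Rightarrow> complex \<Rightarrow> int \<Rightarrow> int \<Rightarrow> int \<Rightarrow> complex \<Rightarrow> complex" where
  "ch_fock_rsn pp pm \<epsilon> r s n = ch_fock pp pm \<epsilon> (of_real (alpha_weight pp pm r s n))"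

definition ch_minimal :: "int \<Rightarrow> int \<Rightarrow> int \<Rightarrow> int \<Rightarrow> complex \<Rightarrow> complex" where
  "ch_minimal pp pm r s \<tau> =
     (theta (pp * pm) (r * pm - s * pp) \<tau> - theta (pp * pm) (r * pm + s * pp) \<tau>)
       / dedekind_eta \<tau>"

text \<open>Meaningful for \<open>1 \<le> r \<le> pp\<close> and \<open>1 \<le> s \<le> pm\<close>, so that a label which is not
  strictly below its bound equals it.  For \<open>Im \<tau> > 0\<close> all series converge absolutely for
  every \<open>\<epsilon>\<close>, because of the Gaussian factor in \<^const>\<open>ch_fock\<close>.\<close>

definition ch_irred ::
  "int \<Rightarrow> int \<Rightarrow> complex \<Rightarrow> int \<Rightarrow> int \<Rightarrow> int \<Rightarrow> complex \<Rightarrow> complex" where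
  "ch_irred pp pm \<epsilon> r s n \<tau> =
    (if r < pp \<and> s < pm then
       of_int n * of_bool (n \<ge> 0)
           * (of_bool (even n) * ch_minimal pp pm r s \<tau>
              - of_bool (odd n) * ch_minimal pp pm r (pm - s) \<tau>)
       + (\<Sum>k::nat. (of_nat k + 1) *
            (ch_fock_rsn pp pm \<epsilon> (pp - r) s (n - 2 * int k - 1) \<tau>
             + ch_fock_rsn pp pm \<epsilon> r (pm - s) (n - 2 * int k - 3) \<tau>
             - ch_fock_rsn pp pm \<epsilon> r s (n - 2 * int k - 2) \<tau>
             - ch_fock_rsn pp pm \<epsilon> (pp - r) (pm - s) (n - 2 * int k - 2) \<tau>))
     else if r < pp then
       (\<Sum>k::nat. ch_fock_rsn pp pm \<epsilon> (pp - r) pm (n - 2 * int k - 1) \<tau>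
                  - ch_fock_rsn pp pm \<epsilon> r pm (n - 2 * int k - 2) \<tau>)
     else if s < pm then
       (\<Sum>k::nat. ch_fock_rsn pp pm \<epsilon> pp s (n - 2 * int k) \<tau>
                  - ch_fock_rsn pp pm \<epsilon> pp (pm - s) (n - 2 * int k - 1) \<tau>)
     else ch_fock_rsn pp pm \<epsilon> pp pm n \<tau>)"

definition ch_vacuum :: "int \<Rightarrow> int \<Rightarrow> complex \<Rightarrow> complex \<Rightarrow> complex" where
  "ch_vacuum pp pm \<epsilon> \<tau> = ch_minimal pp pm 1 1 \<tau> + ch_irred pp pm \<epsilon> 1 1 0 \<tau>"

text \<open>The regularised quantum dimension of a module with regularised character \<open>ch\<close>
  exists and equals \<open>d\<close>.\<close>

definition has_qdim :: "int \<Rightarrow> int \<Rightarrow> complex \<Rightarrow> (complex \<Rightarrow> complex) \<Rightarrow> complex \<Rightarrow> bool" where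
  "has_qdim pp pm \<epsilon> ch d \<longleftrightarrow>
     ((\<lambda>y::real. ch (\<i> * of_real y) / ch_vacuum pp pm \<epsilon> (\<i> * of_real y)) \<longlongrightarrow> d) (at_right 0)"

definition qdim_dists :: "int \<Rightarrow> int \<Rightarrow> complex \<Rightarrow> real set" where
  "qdim_dists pp pm \<epsilon> =
     {\<bar>of_int m / sqrt (2 * of_int pp * of_int pm) - Im \<epsilon>\<bar> |m::int. \<not> pp * pm dvd m}"

definition qdim_bound :: "int \<Rightarrow> int \<Rightarrow> complex \<Rightarrow> real" where
  "qdim_bound pp pm \<epsilon> = - Inf (qdim_dists pp pm \<epsilon>)"

text \<open>The infimum is a minimum.\<close>

lemma Inf_qdim_dists_mem:
  assumes "pp \<ge> 2" "pm \<ge> 2"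
  shows "Inf (qdim_dists pp pm \<epsilon>) \<in> qdim_dists pp pm \<epsilon>"
proof -
  define c where "c = sqrt (2 * real_of_int pp * real_of_int pm)"
  have c: "c > 0" using assms by (simp add: c_def)
  define f where "f = (\<lambda>m::int. \<bar>of_int m / c - Im \<epsilon>\<bar>)"
  define A where "A = {m::int. \<not> pp * pm dvd m}"
  have S: "qdim_dists pp pm \<epsilon> = f ` A"
    by (auto simp: qdim_dists_def f_def A_def c_def)
  have "2 * 2 \<le> pp * pm" using assms by (intro mult_mono) auto
  hence 1: "1 \<in> A" by (auto simp: A_def zdvd_not_zless)
  define T where "T = {m \<in> A. f m \<le> f 1}"
  have "T \<subseteq> {\<lfloor>c * (Im \<epsilon> - f 1)\<rfloor>..\<lceil>c * (Im \<epsilon> + f 1)\<rceil>}"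
  proof
    fix m assume "m \<in> T"
    hence "of_int m / c \<le> Im \<epsilon> + f 1" "of_int m / c \<ge> Im \<epsilon> - f 1"
      by (auto simp: T_def f_def)
    hence "of_int m \<le> c * (Im \<epsilon> + f 1)" "of_int m \<ge> c * (Im \<epsilon> - f 1)"
      using c by (auto simp: field_simps)
    thus "m \<in> {\<lfloor>c * (Im \<epsilon> - f 1)\<rfloor>..\<lceil>c * (Im \<epsilon> + f 1)\<rceil>}"
      by (auto simp: floor_le_iff le_ceiling_iff)
  qed
  hence fin: "finite (f ` T)" by (auto intro: finite_subset)
  have ne: "f ` T \<noteq> {}" using 1 by (auto simp: T_def)
  have mem: "Min (f ` T) \<in> f ` A" using Min_in[OF fin ne] by (auto simp: T_def)
  have le: "Min (f ` T) \<le> f 1" using fin 1 by (auto simp: T_def)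
  have "Min (f ` T) \<le> f m" if "m \<in> A" for m
  proof (cases "f m \<le> f 1")
    case True
    thus ?thesis using that fin by (auto simp: T_def)
  next
    case False
    thus ?thesis using le by linarith
  qed
  hence "Inf (f ` A) = Min (f ` T)" using mem by (intro cInf_eq_minimum) auto
  thus ?thesis using mem S by simp
qed

end

theory Submission
  imports Defs "HOL-Probability.Characteristic_Functions"
begin

text \<open>
  Up to minimal model characters, each character at \<open>\<tau> = iy\<close> times the eta function is a series of
  the terms
  \<open>g(\<mu>) = exp (2\<pi>\<epsilon>\<mu> - \<pi>y\<mu>\<^sup>2)\<close>, with \<open>\<mu>\<close> running through an arithmetic progression of step
  \<open>-\<alpha>\<close>, where \<open>\<alpha> = sqrt (2 p\<^sub>+ p\<^sub>-)\<close>, started at \<open>\<alpha>x\<close> for a few shifts \<open>x\<close> that depend on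
  \<open>r, s, n\<close>; the weights are \<open>1\<close> on the border and \<open>k + 1\<close> in the interior.  The eta function
  does not vanish on the upper imaginary axis and cancels in the quantum dimension, so it
  suffices to find the limit of each of these series as \<open>y\<close> tends to \<open>0\<close> from above.  The term
  of a Fock module tends to \<open>exp (2\<pi>\<epsilon>\<lambda>)\<close>.

  If \<open>Re \<epsilon> > 0\<close>, the factor \<open>exp (2\<pi>\<epsilon>\<mu>)\<close> alone decays geometrically along the progression.
  Dominated convergence then gives the geometric series, or the derivative of one, at \<open>y = 0\<close>
  (\<open>half_sum_limit_pos\<close>), and summing over the shifts gives the product of sines.

  If \<open>Re \<epsilon> < 0\<close>, that factor grows along the progression, and no dominating series exists.
  But a series over a half line equals the sum over the whole lattice minus the sum over the
  complementary half line, and this last sum converges to minus the same rational function of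
  \<open>exp (2\<pi>\<epsilon>\<alpha>)\<close> (\<open>half_sum_limit_neg\<close>).  It remains to see that the signed combination of sums over whole
  lattices tends to \<open>0\<close>.  By Poisson summation (\<open>gauss_poisson\<close>, \<open>mult_gauss_poisson\<close>) it is a
  series over modes \<open>m\<close> whose \<open>m\<close>-th term is, up to powers of \<open>y\<close> and linear factors in \<open>m\<close>,
  of size \<open>exp (\<pi> ((Re \<epsilon>)\<^sup>2 - (m/\<alpha> - Im \<epsilon>)\<^sup>2) / y)\<close>.  When \<open>p\<^sub>+p\<^sub>-\<close> divides \<open>m\<close>, all shifts
  contribute the same phase and the signs cancel the mode (\<open>common_phase\<close>).  For the other
  modes the hypothesis on \<open>Re \<epsilon>\<close> says exactly that the exponent is negative, with a bound
  uniform in \<open>m\<close>, so the combination decays exponentially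
  (\<open>lattice_sum_combination_tendsto_0\<close>).

  The same estimate at \<open>\<epsilon> = 0\<close> shows that the minimal model characters, being differences of
  theta functions, disappear in the limit: only the modes \<open>m \<noteq> 0\<close> survive in such a difference.
\<close>

section \<open>Uniqueness of Fourier coefficients\<close>

definition fourier_null :: "(real \<Rightarrow> complex) \<Rightarrow> bool" where
  "fourier_null h \<longleftrightarrow> continuous_on UNIV h \<and>
     (\<forall>m::int. ((\<lambda>x. h x * cis (2 * pi * of_int m * x)) has_integral 0) {0..1})"

lemma fourier_null_add:
  assumes "fourier_null f" "fourier_null g"
  shows "fourier_null (\<lambda>x. f x + g x)"
proof -
  have "((\<lambda>x. (f x + g x) * cis (2 * pi * of_int m * x)) has_integral 0) {0..1}" for m :: int
  proof -
    have "((\<lambda>x. f x * cis (2 * pi * of_int m * x)) has_integral 0) {0..1}"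
      "((\<lambda>x. g x * cis (2 * pi * of_int m * x)) has_integral 0) {0..1}"
      using assms unfolding fourier_null_def by blast+
    from has_integral_add[OF this] show ?thesis by (simp add: ring_distribs)
  qed
  thus ?thesis using assms unfolding fourier_null_def by (blast intro: continuous_on_add)
qed

lemma fourier_null_cmult:
  assumes "fourier_null f"
  shows "fourier_null (\<lambda>x. f x * c)"
proof -
  have "((\<lambda>x. (f x * c) * cis (2 * pi * of_int m * x)) has_integral 0) {0..1}" for m :: int
    using has_integral_mult_left[of "\<lambda>x. f x * cis (2 * pi * of_int m * x)" 0 "{0..1}" c] assms
    by (simp add: fourier_null_def mult_ac)
  thus ?thesis using assms by (auto simp: fourier_null_def intro!: continuous_intros)
qed

lemma fourier_null_cis:
  assumes "fourier_null f"
  shows "fourier_null (\<lambda>x. f x * cis (2 * pi * of_int j * x))"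
proof -
  have "((\<lambda>x. (f x * cis (2 * pi * of_int j * x)) * cis (2 * pi * of_int m * x)) has_integral 0) {0..1}"
    for m :: int
  proof -
    have "((\<lambda>x. f x * cis (2 * pi * of_int (j + m) * x)) has_integral 0) {0..1}"
      using assms unfolding fourier_null_def by blast
    moreover have "cis (2 * pi * of_int (j + m) * x)
        = cis (2 * pi * of_int j * x) * cis (2 * pi * of_int m * x)" for x :: real
      by (simp add: cis_mult algebra_simps)
    ultimately show ?thesis by (simp add: mult.assoc)
  qed
  thus ?thesis using assms by (auto simp: fourier_null_def intro!: continuous_intros)
qed

text \<open>The condition that all Fourier coefficients vanish is stable under multiplication by
  \<open>cis (\<plusminus>2\<pi>x)\<close>, hence by the two coordinates of the circle point \<open>cis (2\<pi>x)\<close>, hence by polynomials in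
  them.  Quantifying over \<open>h\<close> makes the product case of the induction a composition.\<close>

lemma fourier_null_polynomial:
  assumes "real_polynomial_function p" "fourier_null h"
  shows "fourier_null (\<lambda>x. h x * of_real (p (cis (2 * pi * x))))"
  using assms
proof (induction arbitrary: h rule: real_polynomial_function.induct)
  case (linear f)
  define a b where "a = (of_real (f 1) - \<i> * of_real (f \<i>)) / 2"
    and "b = (of_real (f 1) + \<i> * of_real (f \<i>)) / 2"
  interpret bounded_linear f by fact
  have lin: "f z = Re z * f 1 + Im z * f \<i>" for z
  proof -
    have "z = Re z *\<^sub>R 1 + Im z *\<^sub>R \<i>" by (simp add: complex_eq_iff)
    hence "f z = f (Re z *\<^sub>R 1 + Im z *\<^sub>R \<i>)" by simp
    also have "\<dots> = Re z * f 1 + Im z * f \<i>" unfolding add scaleR by simp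
    finally show ?thesis .
  qed
  have eq: "of_real (f (cis (2 * pi * x))) = cis (2 * pi * of_int 1 * x) * a + cis (2 * pi * of_int (-1) * x) * b" for x
    unfolding lin[of "cis (2 * pi * x)"] by (simp add: complex_eq_iff a_def b_def add_divide_distrib diff_divide_distrib)
  have "(\<lambda>x. h x * of_real (f (cis (2 * pi * x)))) = (\<lambda>x. h x * cis (2 * pi * of_int 1 * x) * a + h x * cis (2 * pi * of_int (-1) * x) * b)"
    unfolding eq by (simp only: distrib_left mult.assoc)
  moreover have "fourier_null (\<lambda>x. h x * cis (2 * pi * of_int 1 * x) * a + h x * cis (2 * pi * of_int (-1) * x) * b)"
    by (intro fourier_null_add fourier_null_cmult fourier_null_cis linear.prems)
  ultimately show ?case by simp
next
  case (const c)
  show ?case by (rule fourier_null_cmult[OF const])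
next
  case (add f g)
  show ?case
    using fourier_null_add[OF add.IH(1)[OF add.prems] add.IH(2)[OF add.prems]]
    by (simp only: of_real_add distrib_left)
next
  case (mult f g)
  show ?case using mult.IH(2)[OF mult.IH(1)[OF mult.prems]] by (simp only: mult.assoc of_real_mult)
qed

lemma periodic_int:
  fixes h :: "real \<Rightarrow> 'a"
  assumes "\<And>x. h (x + 1) = h x"
  shows "h (x + of_int k) = h x"
proof -
  have *: "h (x + of_nat n) = h x" for n x
  proof (induction n)
    case (Suc n)
    thus ?case using assms[of "x + of_nat n"] by (simp add: add_ac)
  qed simp
  show ?thesis
  proof (cases k)
    case (nonneg n) thus ?thesis using * by simp
  next
    case (neg n) thus ?thesis using *[of "x + of_int k" "Suc n"] by simp
  qed
qed

text \<open>The function on the circle is \<open>h (arg z / 2\<pi>)\<close>.  Away from the positive axis the branch of the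
  argument with values in \<open>[0, 2\<pi>)\<close> is continuous, near the positive axis the principal
  branch is; by periodicity the choice of branch does not affect the value.\<close>

lemma periodic_factors_through_circle:
  fixes h :: "real \<Rightarrow> complex"
  assumes cont: "continuous_on UNIV h" and per: "\<And>x. h (x + 1) = h x"
  obtains \<phi> where "continuous_on (sphere 0 1) \<phi>" "\<And>x. \<phi> (cis (2 * pi * x)) = h x"
proof
  define \<phi> where "\<phi> z = h (Arg2pi z / (2 * pi))" for z
  have ch: "isCont h x" for x using cont by (simp add: continuous_on_eq_continuous_at)
  have eq: "h t = \<phi> z" if "z \<noteq> 0" "z = of_real (norm z) * cis (2 * pi * t)" for z t
  proof -
    have "cis (2 * pi * t) = cis (Arg2pi z)"
      using that Arg2pi_eq[of z] by (metis cis_conv_exp mult_cancel_left of_real_eq_0_iff norm_eq_zero)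
    hence "exp (\<i> * of_real (2 * pi * t)) = exp (\<i> * of_real (Arg2pi z))"
      by (simp only: cis_conv_exp)
    then obtain k :: int where "\<i> * of_real (2 * pi * t) = \<i> * of_real (Arg2pi z) + (of_int (2 * k) * pi) * \<i>"
      unfolding exp_eq by blast
    hence "2 * pi * t = Arg2pi z + of_int (2 * k) * pi"
      by (simp add: complex_eq_iff)
    hence "t = Arg2pi z / (2 * pi) + of_int k" by (simp add: field_simps)
    thus ?thesis using periodic_int[of h, OF per] by (simp add: \<phi>_def)
  qed
  show "\<phi> (cis (2 * pi * x)) = h x" for x
    using eq[of "cis (2 * pi * x)" x] by simp
  have "isCont \<phi> z" if z: "z \<in> sphere 0 1" for z
  proof (cases "z \<in> \<real>\<^sub>\<ge>\<^sub>0")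
    case False
    hence "isCont Arg2pi z" by (simp add: continuous_at_Arg2pi)
    hence "isCont (\<lambda>z. Arg2pi z / (2 * pi)) z" by (intro continuous_intros) auto
    from isCont_o2[OF this ch] show ?thesis by (simp add: \<phi>_def[abs_def])
  next
    case True
    have z1: "z \<notin> \<real>\<^sub>\<le>\<^sub>0" using True z
      by (auto simp: complex_nonneg_Reals_iff complex_nonpos_Reals_iff complex_eq_iff cmod_def)
    hence "isCont Arg z" by (simp add: continuous_at_Arg)
    hence "isCont (\<lambda>z. Arg z / (2 * pi)) z" by (intro continuous_intros) auto
    from isCont_o2[OF this ch] have "isCont (\<lambda>z. h (Arg z / (2 * pi))) z" .
    moreover have "eventually (\<lambda>w. h (Arg w / (2 * pi)) = \<phi> w) (nhds z)"
    proof -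
      have "eventually (\<lambda>w. w \<in> - {0}) (nhds z)"
        using z by (intro eventually_nhds_in_open) auto
      thus ?thesis
      proof eventually_elim
        case (elim w)
        show ?case by (rule eq) (use elim Arg_eq[of w] in \<open>auto simp: cis_conv_exp\<close>)
      qed
    qed
    ultimately show ?thesis by (simp add: isCont_cong)
  qed
  thus "continuous_on (sphere 0 1) \<phi>" by (simp add: continuous_at_imp_continuous_on)
qed

text \<open>By the Stone--Weierstrass theorem on the circle, the conjugate of \<open>h\<close> is a uniform limit of
  polynomials in the circle coordinates, and \<open>h\<close> is orthogonal to all of those; so the integral
  of \<open>|h|\<^sup>2\<close> is zero.\<close>

lemma fourier_null_imp_zero:
  assumes null: "fourier_null h" and per: "\<And>x. h (x + 1) = h x"
  shows "h x = 0"
proof -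
  have cont: "continuous_on UNIV h" using null by (simp add: fourier_null_def)
  obtain \<phi> where \<phi>: "continuous_on (sphere 0 1) \<phi>" "\<And>x. \<phi> (cis (2 * pi * x)) = h x"
    using periodic_factors_through_circle[OF cont per] by metis
  have cont01: "continuous_on S h" for S using cont by (rule continuous_on_subset) auto
  have "bounded (h ` {0..1})" by (intro compact_imp_bounded compact_continuous_image cont01) auto
  then obtain M where M: "\<And>x. x \<in> {0..1} \<Longrightarrow> norm (h x) \<le> M" "M > 0"
    unfolding bounded_pos by blast
  define I where "I = integral {0..1} (\<lambda>x. (norm (h x))\<^sup>2)"
  have I: "((\<lambda>x. (norm (h x))\<^sup>2) has_integral I) {0..1}" unfolding I_def
    by (intro integrable_integral integrable_continuous_interval continuous_intros cont01)
  have small: "I \<le> M * (2 * e)" if "e > 0" for e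
  proof -
    obtain p where p: "real_polynomial_function p" "\<And>z. z \<in> sphere 0 1 \<Longrightarrow> \<bar>Re (\<phi> z) - p z\<bar> < e"
      by (rule Stone_Weierstrass_real_polynomial_function[of "sphere 0 1" "\<lambda>z. Re (\<phi> z)" e])
         (use \<phi>(1) \<open>e > 0\<close> in \<open>auto intro!: continuous_intros\<close>)
    obtain r where r: "real_polynomial_function r" "\<And>z. z \<in> sphere 0 1 \<Longrightarrow> \<bar>Im (\<phi> z) - r z\<bar> < e"
      by (rule Stone_Weierstrass_real_polynomial_function[of "sphere 0 1" "\<lambda>z. Im (\<phi> z)" e])
         (use \<phi>(1) \<open>e > 0\<close> in \<open>auto intro!: continuous_intros\<close>)
    define w where "w x = of_real (p (cis (2 * pi * x))) - \<i> * of_real (r (cis (2 * pi * x)))" for x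
    have "fourier_null (\<lambda>x. h x * of_real (p (cis (2 * pi * x))) + h x * of_real (r (cis (2 * pi * x))) * (-\<i>))"
      by (intro fourier_null_add fourier_null_cmult fourier_null_polynomial p r null)
    hence "((\<lambda>x. (h x * of_real (p (cis (2 * pi * x))) + h x * of_real (r (cis (2 * pi * x))) * (-\<i>)) * cis (2 * pi * of_int 0 * x)) has_integral 0) {0..1}"
      unfolding fourier_null_def by blast
    hence "((\<lambda>x. h x * w x) has_integral 0) {0..1}"
      by (simp add: w_def algebra_simps)
    from has_integral_diff[OF has_integral_of_real[OF I] this]
    have int: "((\<lambda>x. h x * (cnj (h x) - w x)) has_integral of_real I) {0..1}"
      by (simp add: algebra_simps complex_norm_square[symmetric] del: of_real_power)
    have "norm (h x * (cnj (h x) - w x)) \<le> M * (2 * e)" if "x \<in> {0..1}" for x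
    proof -
      have "cnj (h x) - w x = of_real (Re (h x) - p (cis (2 * pi * x)))
              + \<i> * of_real (r (cis (2 * pi * x)) - Im (h x))"
        by (simp add: w_def complex_eq_iff)
      hence "norm (cnj (h x) - w x) \<le> \<bar>Re (h x) - p (cis (2 * pi * x))\<bar>
          + \<bar>r (cis (2 * pi * x)) - Im (h x)\<bar>"
        by (metis norm_triangle_ineq norm_of_real norm_mult norm_ii mult_1)
      also have "\<dots> \<le> e + e"
        using p(2)[of "cis (2 * pi * x)"] r(2)[of "cis (2 * pi * x)"] by (simp add: \<phi>(2))
      finally show ?thesis unfolding norm_mult using M that by (intro mult_mono) auto
    qed
    from has_integral_bound[OF _ int[folded box_real(2)]] this
    have "norm (complex_of_real I) \<le> M * (2 * e) * measure lborel {0..1::real}" 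
      using M(2) \<open>e > 0\<close> by (auto simp: box_real)
    thus ?thesis by simp
  qed
  have "I \<le> 0"
  proof (rule ccontr)
    assume "\<not> I \<le> 0"
    hence "I \<le> M * (2 * (I / (4 * M)))" using M(2) by (intro small) auto
    thus False using M(2) \<open>\<not> I \<le> 0\<close> by (simp add: field_simps)
  qed
  moreover have "I \<ge> 0" by (rule has_integral_nonneg[OF I]) auto
  ultimately have "((\<lambda>x. (norm (h x))\<^sup>2) has_integral 0) (cbox 0 1)" using I by simp
  hence z: "(norm (h x))\<^sup>2 = 0" if "x \<in> {0..1}" for x
    by (intro has_integral_0_cbox_imp_0[of 0 1 "\<lambda>x. (norm (h x))\<^sup>2"])
       (use that in \<open>auto intro!: continuous_intros cont01\<close>)
  have "h x = h (frac x + of_int \<lfloor>x\<rfloor>)" by (simp add: frac_def)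
  also have "\<dots> = h (frac x)" using periodic_int[of h "frac x" "\<lfloor>x\<rfloor>"] per by simp
  also have "\<dots> = 0" using z[of "frac x"] frac_lt_1[of x] by (simp add: less_imp_le)
  finally show ?thesis .
qed

section \<open>Poisson summation\<close>

lemma summable_on_inverse_squares_int:
  "(\<lambda>v::int. 1 / (1 + (of_int v)\<^sup>2 :: real)) summable_on UNIV"
proof -
  have "summable (\<lambda>n::nat. 2 * (1 / (real n + 1)\<^sup>2))"
    using inverse_squares_sums by (intro summable_mult) (auto simp: sums_iff add_ac)
  hence nat: "summable (\<lambda>n::nat. 1 / (1 + (real n)\<^sup>2))"
  proof (rule summable_comparison_test'[where N = 0])
    fix n :: nat
    have "(real n + 1)\<^sup>2 \<le> 2 * (1 + (real n)\<^sup>2)"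
      using sum_squares_bound[of "real n" 1] by (simp add: power2_eq_square algebra_simps)
    thus "norm (1 / (1 + (real n)\<^sup>2)) \<le> 2 * (1 / (real n + 1)\<^sup>2)"
      by (simp add: divide_simps add_pos_nonneg)
  qed
  hence nat': "(\<lambda>n::nat. 1 / (1 + (real n)\<^sup>2)) summable_on UNIV"
    by (rule summable_nonneg_imp_summable_on) auto
  have "(\<lambda>v::int. 1 / (1 + (of_int v)\<^sup>2 :: real)) summable_on range int"
    by (subst summable_on_reindex) (use nat' in \<open>auto simp: o_def\<close>)
  moreover have "(\<lambda>v::int. 1 / (1 + (of_int v)\<^sup>2 :: real)) summable_on range (\<lambda>n. - int n)"
    by (subst summable_on_reindex) (use nat' in \<open>auto simp: o_def inj_on_def\<close>)
  ultimately have "(\<lambda>v::int. 1 / (1 + (of_int v)\<^sup>2 :: real)) summable_on (range int \<union> range (\<lambda>n. - int n))"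
    by (rule summable_on_union)
  also have "range int \<union> range (\<lambda>n. - int n) = UNIV"
  proof -
    have "v \<in> range int \<union> range (\<lambda>n. - int n)" for v
      by (cases v rule: int_cases2) auto
    thus ?thesis by blast
  qed
  finally show ?thesis .
qed

lemma has_sum_integral_dominated:
  fixes f :: "'i \<Rightarrow> real \<Rightarrow> complex"
  assumes cont: "\<And>v. continuous_on {0..1} (f v)"
    and bound: "\<And>v x. x \<in> {0..1} \<Longrightarrow> norm (f v x) \<le> M v" and M: "M summable_on UNIV"
    and int: "\<And>v. (f v has_integral J v) {0..1}"
    and sum: "(J has_sum S) UNIV"
  shows "((\<lambda>x. \<Sum>\<^sub>\<infinity>v. f v x) has_integral S) {0..1}"
proof -
  have "uniform_limit {0..1} (\<lambda>X x. \<Sum>v\<in>X. f v x) (\<lambda>x. \<Sum>\<^sub>\<infinity>v. f v x) (finite_subsets_at_top UNIV)"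
    using bound M by (intro Weierstrass_m_test_general[where M = M]) auto
  then obtain I K where IK: "\<And>X. ((\<lambda>x. \<Sum>v\<in>X. f v x) has_integral I X) {0..1}"
      "((\<lambda>x. \<Sum>\<^sub>\<infinity>v. f v x) has_integral K) {0..1}" "(I \<longlongrightarrow> K) (finite_subsets_at_top UNIV)"
    by (rule uniform_limit_integral) (auto intro!: continuous_on_sum cont)
  have "I X = sum J X" if "finite X" for X
    by (rule has_integral_unique[OF IK(1)]) (intro has_integral_sum that int)
  hence "eventually (\<lambda>X. I X = sum J X) (finite_subsets_at_top UNIV)"
    by (intro eventually_finite_subsets_at_top_weakI) auto
  hence "(sum J \<longlongrightarrow> K) (finite_subsets_at_top UNIV)"
    using IK(3) by (simp add: tendsto_cong)
  hence "(J has_sum K) UNIV" by (simp add: has_sum_def)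
  hence "K = S" using sum by (rule has_sum_unique)
  thus ?thesis using IK(2) by simp
qed

lemma filterlim_symmetric_intervals:
  "filterlim (\<lambda>N::nat. {- int N..<int N}) (finite_subsets_at_top UNIV) sequentially"
  unfolding filterlim_finite_subsets_at_top
proof (intro allI impI)
  fix X :: "int set" assume X: "finite X \<and> X \<subseteq> UNIV"
  define B where "B = (\<Sum>x\<in>X. nat \<bar>x\<bar>)"
  have "nat \<bar>x\<bar> \<le> B" if "x \<in> X" for x
    unfolding B_def using X that by (intro member_le_sum) auto
  hence "X \<subseteq> {- int N..<int N}" if "N > B" for N
    using that by (force simp: nat_le_iff)
  thus "\<forall>\<^sub>F y in sequentially. finite {- int y..<int y} \<and> X \<subseteq> {- int y..<int y} \<and> {- int y..<int y} \<subseteq> UNIV"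
    by (auto intro: eventually_mono[OF eventually_gt_at_top[of B]])
qed

lemma sum_integral_unit_intervals:
  fixes g :: "real \<Rightarrow> complex"
  assumes "continuous_on UNIV g"
  shows "(\<Sum>v\<in>{- int N..<int N}. integral {of_int v..of_int v + 1} g) = integral {- real N..real N} g"
proof (induction N)
  case (Suc N)
  have ig: "g integrable_on {a..b}" for a b
    by (intro integrable_continuous_interval continuous_on_subset[OF assms]) auto
  have "{- int (Suc N)..<int (Suc N)} = insert (- int (Suc N)) (insert (int N) {- int N..<int N})"
    by auto
  hence "(\<Sum>v\<in>{- int (Suc N)..<int (Suc N)}. integral {of_int v..of_int v + 1} g)
      = integral {- real (Suc N)..- real N} g + (integral {real N..real (Suc N)} g + integral {- real N..real N} g)"
    using Suc by (simp add: add_ac)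
  also have "\<dots> = integral {- real (Suc N)..real (Suc N)} g"
    using Henstock_Kurzweil_Integration.integral_combine[of "- real (Suc N)" "- real N" "real (Suc N)" g]
      Henstock_Kurzweil_Integration.integral_combine[of "- real N" "real N" "real (Suc N)" g] ig
    by (simp add: add_ac)
  finally show ?case .
qed simp

lemma has_integral_cis_unit:
  "((\<lambda>x. cis (2 * pi * of_int k * x)) has_integral (if k = 0 then 1 else 0)) {0..1}"
proof (cases "k = 0")
  case True
  thus ?thesis using has_integral_const_real[of "1::complex" 0 1] by simp
next
  case False
  define w where "w = 2 * of_real pi * of_int k * \<i>"
  have w: "w \<noteq> 0" using False by (simp add: w_def)
  have "((\<lambda>x. exp (w * of_real x) / w) has_vector_derivative exp (w * of_real x)) (at x within {0..1})" for x :: real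
  proof -
    have "((\<lambda>z. exp (w * z) / w) has_field_derivative exp (w * of_real x)) (at (of_real x))"
      using w by (auto intro!: derivative_eq_intros)
    from has_vector_derivative_real_field[OF this] show ?thesis by simp
  qed
  hence "((\<lambda>x. exp (w * of_real x)) has_integral (exp (w * of_real 1) / w - exp (w * of_real 0) / w)) {0..1}"
    by (intro fundamental_theorem_of_calculus) auto
  moreover have "exp w = 1"
    using exp_integer_2pi[of "of_int k"] by (simp add: w_def mult_ac)
  ultimately show ?thesis using False by (simp add: w_def cis_conv_exp mult_ac)
qed

text \<open>Both sides are continuous functions of \<open>x\<close> with period \<open>1\<close>, so it suffices to compare their
  Fourier coefficients.  On the left, integrating term by term over \<open>[0, 1]\<close> pieces together
  the integral of \<open>G\<close> against a character over the real line.  That integral enters only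
  as a limit over symmetric intervals, which is what can be computed directly later on.\<close>

lemma poisson_summation:
  fixes G :: "real \<Rightarrow> complex" and c :: "int \<Rightarrow> complex"
  assumes cont: "continuous_on UNIV G"
    and bound: "\<And>t. norm (G t) \<le> C / (1 + t\<^sup>2)"
    and coeff: "\<And>m. (\<lambda>N. integral {- real N..real N} (\<lambda>t. G t * cis (- (2 * pi * of_int m * t))))
                      \<longlonglongrightarrow> c m"
    and summ: "(\<lambda>m. norm (c m)) summable_on UNIV"
  shows "(\<Sum>\<^sub>\<infinity>v::int. G (x + of_int v)) = (\<Sum>\<^sub>\<infinity>m. c m * cis (2 * pi * of_int m * x))"
    and "(\<lambda>v::int. norm (G (x + of_int v))) summable_on UNIV"
proof -
  define f where "f = (\<lambda>x. \<Sum>\<^sub>\<infinity>v::int. G (x + of_int v))"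
  define g where "g = (\<lambda>x. \<Sum>\<^sub>\<infinity>m. c m * cis (2 * pi * of_int m * x))"
  define M where "M R v = 2 * (1 + R\<^sup>2) * C * (1 / (1 + (of_int v :: real)\<^sup>2))" for R :: real and v
  have C: "C \<ge> 0" using order_trans[OF norm_ge_zero bound[of 0]] by simp
  have M: "M R summable_on UNIV" for R
    unfolding M_def by (intro summable_on_cmult_right summable_on_inverse_squares_int)
  have GM: "norm (G (x + of_int v)) \<le> M R v" if "\<bar>x\<bar> \<le> R" for x v R
  proof -
    have "1 + (of_int v)\<^sup>2 \<le> 1 + 2 * (x + of_int v)\<^sup>2 + 2 * x\<^sup>2"
      using zero_le_power2[of "2 * x + of_int v"] by (simp add: power2_eq_square algebra_simps)
    also have "\<dots> \<le> 2 * (1 + x\<^sup>2) * (1 + (x + of_int v)\<^sup>2)"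
      by (simp add: algebra_simps)
    also have "\<dots> \<le> 2 * (1 + R\<^sup>2) * (1 + (x + of_int v)\<^sup>2)"
      using that by (intro mult_right_mono mult_left_mono add_left_mono) (auto simp: abs_le_square_iff[symmetric])
    finally have "1 / (1 + (x + of_int v)\<^sup>2) \<le> 2 * (1 + R\<^sup>2) * (1 / (1 + (of_int v)\<^sup>2))"
      by (simp add: divide_simps add_pos_nonneg mult_ac)
    from mult_left_mono[OF this C] bound[of "x + of_int v"] show ?thesis
      by (simp add: M_def mult_ac)
  qed
  show "(\<lambda>v::int. norm (G (x + of_int v))) summable_on UNIV"
    by (rule Infinite_Sum.abs_summable_on_comparison_test'[OF M[of "\<bar>x\<bar>"]]) (use GM in auto)
  \<comment> \<open>The dominating series depends on the size of the argument, so continuity is first shown on bounded intervals.\<close>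
  have contf: "continuous_on {-R..R} f" for R
  proof (rule uniform_limit_theorem)
    show "uniform_limit {-R..R} (\<lambda>X x. \<Sum>v\<in>X. G (x + of_int v)) f (finite_subsets_at_top UNIV)"
      unfolding f_def using GM M by (intro Weierstrass_m_test_general[where M = "M R"]) auto
    show "\<forall>\<^sub>F X in finite_subsets_at_top UNIV. continuous_on {-R..R} (\<lambda>x. \<Sum>v\<in>X. G (x + real_of_int v))"
      by (intro always_eventually allI continuous_on_sum continuous_on_compose2[OF cont] continuous_intros) auto
  qed simp
  have contf': "continuous_on UNIV f"
  proof -
    have "isCont f x" for x
      by (rule continuous_on_interior[OF contf[of "\<bar>x\<bar> + 1"]]) (auto simp: interior_atLeastAtMost_real)
    thus ?thesis by (simp add: continuous_at_imp_continuous_on)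
  qed
  have contg: "continuous_on UNIV g"
  proof (rule uniform_limit_theorem)
    show "uniform_limit UNIV (\<lambda>X x. \<Sum>m\<in>X. c m * cis (2 * pi * of_int m * x)) g (finite_subsets_at_top UNIV)"
      unfolding g_def using summ by (intro Weierstrass_m_test_general[where M = "\<lambda>m. norm (c m)"]) (auto simp: norm_mult)
    show "\<forall>\<^sub>F X in finite_subsets_at_top UNIV. continuous_on UNIV (\<lambda>x. \<Sum>m\<in>X. c m * cis (2 * pi * of_int m * x))"
      by (intro always_eventually allI continuous_intros)
  qed simp
  have cont': "continuous_on A (\<lambda>t. G (t + a))" for A a
    by (rule continuous_on_compose2[OF cont]) (auto intro!: continuous_intros)
  have intf: "((\<lambda>x. f x * cis (2 * pi * of_int j * x)) has_integral c (- j)) {0..1}" for j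
  proof -
    \<comment> \<open>The character is invariant under integer translations, so it can be moved into the summand.\<close>
    define h where "h = (\<lambda>t. G t * cis (2 * pi * of_int j * t))"
    have conth: "continuous_on A h" for A
      unfolding h_def by (intro continuous_intros continuous_on_subset[OF cont]) auto
    have shift: "G (x + of_int v) * cis (2 * pi * of_int j * x) = h (x + of_int v)" for v x
    proof -
      have "cis (2 * pi * of_int j * (x + of_int v)) = cis (2 * pi * of_int j * x) * cis (2 * pi * of_int (j * v))"
        by (simp add: cis_mult algebra_simps)
      also have "cis (2 * pi * of_int (j * v)) = 1"
        by (rule cis_multiple_2pi) simp
      finally show ?thesis by (simp add: h_def)
    qed
    define J where "J v = integral {of_int v..of_int v + 1} h" for v
    have int: "((\<lambda>x. G (x + of_int v) * cis (2 * pi * of_int j * x)) has_integral J v) {0..1}" for v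
    proof -
      have "(h has_integral J v) {of_int v..of_int v + 1}"
        unfolding J_def by (intro integrable_integral integrable_continuous_interval conth)
      from has_integral_shift_real_ivl[OF this, of "of_int v"] show ?thesis
        by (simp add: shift)
    qed
    have "norm (J v) \<le> M 1 v" for v
    proof -
      have "norm (J v) \<le> M 1 v * measure lborel {0..1::real}"
      proof (rule has_integral_bound[of _ "\<lambda>x. G (x + of_int v) * cis (2 * pi * of_int j * x)" _ 0 1, unfolded box_real])
        show "0 \<le> M 1 v" using C by (simp add: M_def)
      qed (use int GM[of _ 1 v] in \<open>auto simp: norm_mult\<close>)
      thus ?thesis by simp
    qed
    hence "(\<lambda>v. norm (J v)) summable_on UNIV" by (intro Infinite_Sum.abs_summable_on_comparison_test'[OF M[of 1]])
    hence S: "(J has_sum infsum J UNIV) UNIV"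
      using abs_summable_summable has_sum_infsum by blast
    \<comment> \<open>The unit intervals tile the symmetric intervals along which the coefficient is a limit.\<close>
    hence "(\<lambda>N. sum J {- int N..<int N}) \<longlonglongrightarrow> infsum J UNIV"
      using filterlim_compose[OF _ filterlim_symmetric_intervals] unfolding has_sum_def by blast
    moreover have "(\<lambda>N. sum J {- int N..<int N}) \<longlonglongrightarrow> c (- j)"
      using coeff[of "- j"] unfolding J_def sum_integral_unit_intervals[OF conth] by (simp add: h_def)
    ultimately have "infsum J UNIV = c (- j)" by (rule LIMSEQ_unique)
    with S have sum: "(J has_sum c (- j)) UNIV" by simp
    have "((\<lambda>x. \<Sum>\<^sub>\<infinity>v::int. G (x + of_int v) * cis (2 * pi * of_int j * x)) has_integral c (- j)) {0..1}"
      by (rule has_sum_integral_dominated[where M = "M 1", OF _ _ M int sum])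
         (use GM[of _ 1] in \<open>auto intro!: continuous_intros cont' simp: norm_mult\<close>)
    thus ?thesis by (simp add: f_def infsum_cmult_left')
  qed
  have intg: "((\<lambda>x. g x * cis (2 * pi * of_int j * x)) has_integral c (- j)) {0..1}" for j
  proof -
    define J where "J m = (if m = - j then c (- j) else 0)" for m
    have int: "((\<lambda>x. c m * cis (2 * pi * of_int m * x) * cis (2 * pi * of_int j * x)) has_integral J m) {0..1}" for m
    proof -
      have cis: "c m * cis (2 * pi * of_int m * x) * cis (2 * pi * of_int j * x) = c m * cis (2 * pi * of_int (m + j) * x)" for x :: real
        by (simp add: cis_mult algebra_simps)
      have J: "J m = c m * (if m + j = 0 then 1 else 0)"
        by (auto simp: J_def add_eq_0_iff2)
      show ?thesis unfolding cis J by (intro has_integral_mult_right has_integral_cis_unit)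
    qed
    have sum: "(J has_sum c (- j)) UNIV"
      by (rule has_sum_finite_neutralI[of "{- j}"]) (auto simp: J_def)
    have "((\<lambda>x. \<Sum>\<^sub>\<infinity>m. c m * cis (2 * pi * of_int m * x) * cis (2 * pi * of_int j * x)) has_integral c (- j)) {0..1}"
      by (rule has_sum_integral_dominated[where M = "\<lambda>m. norm (c m)", OF _ _ summ int sum])
         (auto intro!: continuous_intros simp: norm_mult)
    thus ?thesis by (simp add: g_def infsum_cmult_left')
  qed
  have "fourier_null (\<lambda>x. f x - g x)"
    unfolding fourier_null_def left_diff_distrib
  proof (intro conjI allI)
    show "((\<lambda>x. f x * cis (2 * pi * of_int j * x) - g x * cis (2 * pi * of_int j * x)) has_integral 0) {0..1}" for j
      using has_integral_diff[OF intf[of j] intg[of j]] by simp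
  qed (intro continuous_intros contf' contg)
  moreover have "f (x + 1) - g (x + 1) = f x - g x" for x
  proof -
    have "f (x + 1) = f x" unfolding f_def
      by (rule infsum_reindex_bij_witness[of _ "\<lambda>v. v - 1" "\<lambda>v. v + 1"]) (auto simp: add_ac)
    moreover have "cis (2 * pi * of_int m * (x + 1)) = cis (2 * pi * of_int m * x)" for m
    proof -
      have "cis (2 * pi * of_int m * (x + 1)) = cis (2 * pi * of_int m * x) * cis (2 * pi * of_int m)"
        by (simp add: cis_mult algebra_simps)
      also have "cis (2 * pi * of_int m) = 1" by (rule cis_multiple_2pi) simp
      finally show ?thesis by simp
    qed
    ultimately show ?thesis by (simp add: g_def)
  qed
  ultimately have "f x - g x = 0" by (rule fourier_null_imp_zero)
  thus "(\<Sum>\<^sub>\<infinity>v::int. G (x + of_int v)) = (\<Sum>\<^sub>\<infinity>m. c m * cis (2 * pi * of_int m * x))"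
    by (simp add: f_def g_def)
qed

section \<open>Fourier transform of a complex Gaussian\<close>

text \<open>Completing the square leaves a centred Gaussian, which is bounded by \<open>1 / (1 + t\<^sup>2)\<^sup>2\<close> up to a
  constant because \<open>exp u \<ge> u\<^sup>2 / 2\<close>.  The factor \<open>1 + |t|\<close> covers both a Gaussian and its product
  with \<open>t\<close>.\<close>

lemma gaussian_decay_real:
  fixes a b :: real
  assumes "a > 0"
  obtains C where "\<And>t. (1 + \<bar>t\<bar>) * exp (b * t - a * t\<^sup>2) \<le> C / (1 + t\<^sup>2)"
proof
  fix t :: real
  define s where "s = a / 2"
  have s: "s > 0" using assms by (simp add: s_def)
  define u where "u = s * (1 + t\<^sup>2)"
  have u: "u > 0" unfolding u_def using s by (intro mult_pos_pos add_pos_nonneg) auto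
  have "0 \<le> s * (t - b / a)\<^sup>2" using s by simp
  also have "s * (t - b / a)\<^sup>2 = s * t\<^sup>2 - b * t + b\<^sup>2 / (2 * a)"
    using assms by (simp add: s_def power2_eq_square field_simps)
  finally have "b * t - a * t\<^sup>2 \<le> b\<^sup>2 / (2 * a) - s * t\<^sup>2" by (simp add: s_def)
  also have "\<dots> = (b\<^sup>2 / (2 * a) + s) - u" by (simp add: u_def algebra_simps)
  finally have "exp (b * t - a * t\<^sup>2) \<le> exp ((b\<^sup>2 / (2 * a) + s) - u)" by simp
  also have "\<dots> = exp (b\<^sup>2 / (2 * a) + s) / exp u" by (rule exp_diff)
  also have "\<dots> \<le> exp (b\<^sup>2 / (2 * a) + s) / (u\<^sup>2 / 2)"
    using exp_lower_Taylor_quadratic[of u] u by (intro divide_left_mono) auto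
  finally have 1: "exp (b * t - a * t\<^sup>2) \<le> exp (b\<^sup>2 / (2 * a) + s) / (u\<^sup>2 / 2)" .
  have "\<bar>t\<bar> \<le> 1 + t\<^sup>2"
    using sum_squares_bound[of "\<bar>t\<bar>" 1] by simp
  hence 2: "1 + \<bar>t\<bar> \<le> 2 * (1 + t\<^sup>2)" using zero_le_power2[of t] unfolding distrib_left by linarith
  have "(1 + \<bar>t\<bar>) * exp (b * t - a * t\<^sup>2) \<le> 2 * (1 + t\<^sup>2) * (exp (b\<^sup>2 / (2 * a) + s) / (u\<^sup>2 / 2))"
    by (intro mult_mono 1 2) auto
  also have "\<dots> = (4 * exp (b\<^sup>2 / (2 * a) + s) / s\<^sup>2) / (1 + t\<^sup>2)"
  proof -
    have "2 * w * (E / ((s * w)\<^sup>2 / 2)) = (4 * E / s\<^sup>2) / w" if "w > 0" for w E :: real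
      using s that by (simp add: power2_eq_square)
    from this[of "1 + t\<^sup>2"] show ?thesis by (simp add: u_def add_pos_nonneg)
  qed
  finally show "(1 + \<bar>t\<bar>) * exp (b * t - a * t\<^sup>2) \<le> (4 * exp (b\<^sup>2 / (2 * a) + s) / s\<^sup>2) / (1 + t\<^sup>2)" .
qed

text \<open>This is the characteristic function of the standard normal distribution.\<close>

lemma has_bochner_integral_iexp_std_normal:
  "has_bochner_integral lborel (\<lambda>x. exp (\<i> * of_real (t * x) - of_real (x\<^sup>2 / 2)))
     (of_real (sqrt (2 * pi)) * exp (- of_real (t\<^sup>2 / 2)))"
proof -
  have eq: "std_normal_density x *\<^sub>R iexp (t * x) = exp (\<i> * of_real (t * x) - of_real (x\<^sup>2 / 2)) * of_real (1 / sqrt (2 * pi))" for x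
  proof -
    have "exp (\<i> * of_real (t * x) - of_real (x\<^sup>2 / 2)) = iexp (t * x) * of_real (exp (- (x\<^sup>2 / 2)))"
      by (simp only: diff_conv_add_uminus exp_add of_real_minus[symmetric] exp_of_real)
    thus ?thesis by (simp only: std_normal_density_def scaleR_conv_of_real of_real_mult mult_ac) simp
  qed
  have "integrable lborel (\<lambda>x. std_normal_density x *\<^sub>R iexp (t * x))"
    by (rule Bochner_Integration.integrable_bound[of _ "std_normal_density"])
       (auto simp: integrable_normal_density)
  moreover have "(LINT x|lborel. std_normal_density x *\<^sub>R iexp (t * x)) = exp (- of_real (t\<^sup>2 / 2))"
    using char_std_normal_distribution unfolding char_def fun_eq_iff
    by (subst (asm) integral_density) (auto simp: normal_density_nonneg exp_of_real[symmetric])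
  ultimately have "has_bochner_integral lborel (\<lambda>x. std_normal_density x *\<^sub>R iexp (t * x)) (exp (- of_real (t\<^sup>2 / 2)))"
    by (simp add: has_bochner_integral_iff)
  from has_bochner_integral_mult_right[OF this, of "of_real (sqrt (2 * pi))"] show ?thesis
    unfolding eq by simp
qed

text \<open>The real part of \<open>B\<close> is removed by the real translation by \<open>t0 = Re B / 2A\<close>, and rescaling by
  \<open>c\<close> turns the imaginary part into the argument of the characteristic function of the standard
  normal distribution, so no contour has to be moved.\<close>

lemma has_bochner_integral_gaussian_complex:
  fixes A :: real and B :: complex
  assumes "A > 0"
  shows "has_bochner_integral lborel (\<lambda>t. exp (B * of_real t - of_real (A * t\<^sup>2)))
     (of_real (sqrt (pi / A)) * exp (B\<^sup>2 / of_real (4 * A)))"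
proof -
  define c where "c = 1 / sqrt (2 * A)"
  define t0 where "t0 = Re B / (2 * A)"
  define K where "K = exp (of_real ((Re B)\<^sup>2 / (4 * A)) + \<i> * of_real (Im B * t0))"
  have c: "c > 0" using assms by (simp add: c_def)
  have c2: "c\<^sup>2 = 1 / (2 * A)" using assms by (simp add: c_def power_divide)
  have re: "Re B * (t0 + c * x) - A * (t0 + c * x)\<^sup>2 = (Re B)\<^sup>2 / (4 * A) - x\<^sup>2 / 2" for x
  proof -
    have "A * (t0 + c * x)\<^sup>2 = A * t0\<^sup>2 + 2 * A * t0 * c * x + A * c\<^sup>2 * x\<^sup>2"
      by (simp add: power2_eq_square algebra_simps)
    also have "A * c\<^sup>2 = 1 / 2" using assms by (simp add: c2)
    finally show ?thesis using assms by (simp add: t0_def power2_eq_square field_simps)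
  qed
  have eq: "exp (B * of_real (t0 + c * x) - of_real (A * (t0 + c * x)\<^sup>2))
      = K * exp (\<i> * of_real ((Im B * c) * x) - of_real (x\<^sup>2 / 2))" for x
  proof -
    have "B * of_real (t0 + c * x) - of_real (A * (t0 + c * x)\<^sup>2)
        = of_real (Re B * (t0 + c * x) - A * (t0 + c * x)\<^sup>2) + \<i> * of_real (Im B * (t0 + c * x))"
      by (simp add: complex_eq_iff del: of_real_add of_real_mult)
    also have "\<dots> = (of_real ((Re B)\<^sup>2 / (4 * A)) + \<i> * of_real (Im B * t0)) + (\<i> * of_real ((Im B * c) * x) - of_real (x\<^sup>2 / 2))"
      unfolding re by (simp add: complex_eq_iff algebra_simps)
    finally show ?thesis by (simp only: exp_add K_def)
  qed
  have "has_bochner_integral lborel (\<lambda>x. K * exp (\<i> * of_real ((Im B * c) * x) - of_real (x\<^sup>2 / 2)))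
     (K * (of_real (sqrt (2 * pi)) * exp (- of_real ((Im B * c)\<^sup>2 / 2))))"
    by (intro has_bochner_integral_mult_right has_bochner_integral_iexp_std_normal)
  also have "K * (of_real (sqrt (2 * pi)) * exp (- of_real ((Im B * c)\<^sup>2 / 2)))
      = (of_real (sqrt (pi / A)) * exp (B\<^sup>2 / of_real (4 * A))) /\<^sub>R \<bar>c\<bar>"
  proof -
    have "K * exp (- of_real ((Im B * c)\<^sup>2 / 2)) = exp (of_real ((Re B)\<^sup>2 / (4 * A)) + \<i> * of_real (Im B * t0) - of_real ((Im B * c)\<^sup>2 / 2))"
      by (simp only: K_def diff_conv_add_uminus exp_add)
    also have "of_real ((Re B)\<^sup>2 / (4 * A)) + \<i> * of_real (Im B * t0) - of_real ((Im B * c)\<^sup>2 / 2) = B\<^sup>2 / of_real (4 * A)"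
    proof -
      have "B\<^sup>2 / of_real (4 * A) = Complex (((Re B)\<^sup>2 - (Im B)\<^sup>2) / (4 * A)) (2 * Re B * Im B / (4 * A))"
        by (simp add: complex_eq_iff power2_eq_square del: of_real_mult)
      thus ?thesis using assms
        by (simp add: complex_eq_iff t0_def power_mult_distrib c2 field_simps del: of_real_mult of_real_divide of_real_power)
    qed
    finally have 1: "K * exp (- of_real ((Im B * c)\<^sup>2 / 2)) = exp (B\<^sup>2 / of_real (4 * A))" .
    have "sqrt (pi / A) / c = sqrt (2 * pi)"
      using assms by (simp add: c_def real_sqrt_divide real_sqrt_mult)
    hence 2: "of_real (sqrt (2 * pi)) = complex_of_real (sqrt (pi / A)) / of_real c" by (metis of_real_divide)
    have "K * (of_real (sqrt (2 * pi)) * exp (- of_real ((Im B * c)\<^sup>2 / 2)))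
        = of_real (sqrt (2 * pi)) * (K * exp (- of_real ((Im B * c)\<^sup>2 / 2)))"
      by (simp only: mult_ac)
    also have "\<dots> = of_real (sqrt (pi / A)) / of_real c * exp (B\<^sup>2 / of_real (4 * A))"
      by (simp only: 1 2)
    also have "\<dots> = (of_real (sqrt (pi / A)) * exp (B\<^sup>2 / of_real (4 * A))) /\<^sub>R \<bar>c\<bar>"
      using c by (simp only: abs_of_pos scaleR_conv_of_real of_real_inverse divide_inverse mult_ac)
    finally show ?thesis .
  qed
  finally show ?thesis unfolding eq[symmetric]
    using c by (subst lborel_has_bochner_integral_real_affine_iff[where c = c and t = t0]) auto
qed

lemma tendsto_integral_symmetric_interval:
  fixes f :: "real \<Rightarrow> complex"
  assumes f: "has_bochner_integral lborel f I" and cont: "continuous_on UNIV f"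
  shows "(\<lambda>N. integral {- real N..real N} f) \<longlonglongrightarrow> I"
proof -
  have int: "integrable lborel f" "integral\<^sup>L lborel f = I" using f by (auto simp: has_bochner_integral_iff)
  have "(\<lambda>N. LINT x|lborel. indicator {- real N..real N} x *\<^sub>R f x) \<longlonglongrightarrow> (LINT x|lborel. f x)"
  proof (rule integral_dominated_convergence[where w = "\<lambda>x. norm (f x)"])
    show "AE x in lborel. (\<lambda>N. indicator {- real N..real N} x *\<^sub>R f x) \<longlonglongrightarrow> f x"
    proof (intro AE_I2 tendsto_eventually)
      fix x :: real
      obtain N0 where N0: "\<bar>x\<bar> \<le> real N0" using real_arch_simple by blast
      show "\<forall>\<^sub>F N in sequentially. indicator {- real N..real N} x *\<^sub>R f x = f x"
        using eventually_ge_at_top[of N0] 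
      proof eventually_elim
        case (elim N)
        hence "real N0 \<le> real N" by simp
        hence "x \<in> {- real N..real N}" using N0 by auto
        thus ?case by simp
      qed
    qed
  qed (use int(1) in \<open>auto simp: indicator_def\<close>)
  moreover have "(LINT x|lborel. indicator {- real N..real N} x *\<^sub>R f x) = integral {- real N..real N} f" for N
  proof -
    have "set_integrable lborel {- real N..real N} f"
      unfolding set_integrable_def using int(1) by (intro integrable_mult_indicator) auto
    from set_borel_integral_eq_integral(2)[OF this] show ?thesis
      by (simp add: set_lebesgue_integral_def)
  qed
  ultimately show ?thesis using int(2) by simp
qed

text \<open>The value at \<open>\<tau> = iy\<close> of \<open>exp (2\<pi>\<epsilon>\<mu>) q^(\<mu>\<^sup>2/2)\<close>, that is, of a regularised Fock module character
  times the eta function.\<close>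

definition gauss :: "complex \<Rightarrow> real \<Rightarrow> complex \<Rightarrow> complex" where
  "gauss \<epsilon> y \<mu> = exp (2 * of_real pi * \<epsilon> * \<mu> - of_real (pi * y) * \<mu>\<^sup>2)"

text \<open>The Fourier transform of \<open>t \<mapsto> gauss \<epsilon> y (\<alpha>t)\<close> at the integer \<open>m\<close>.\<close>

definition dual_gauss :: "real \<Rightarrow> complex \<Rightarrow> real \<Rightarrow> int \<Rightarrow> complex" where
  "dual_gauss \<alpha> \<epsilon> y m = exp (of_real pi * (\<epsilon> - \<i> * of_real (of_int m / \<alpha>))\<^sup>2 / of_real y) / of_real (\<alpha> * sqrt y)"

lemma norm_gauss: "norm (gauss \<epsilon> y (of_real \<mu>)) = exp (2 * pi * Re \<epsilon> * \<mu> - pi * y * \<mu>\<^sup>2)"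
  by (simp add: gauss_def norm_exp_eq_Re flip: of_real_power)

lemma norm_dual_gauss:
  assumes "\<alpha> > 0" "y > 0"
  shows "norm (dual_gauss \<alpha> \<epsilon> y m) = exp (- (pi * ((Im \<epsilon> - of_int m / \<alpha>)\<^sup>2 - (Re \<epsilon>)\<^sup>2) / y)) / (\<alpha> * sqrt y)"
proof -
  have re: "Re ((\<epsilon> - \<i> * of_real (of_int m / \<alpha>))\<^sup>2) = (Re \<epsilon>)\<^sup>2 - (Im \<epsilon> - of_int m / \<alpha>)\<^sup>2"
    by (simp add: Re_power2)
  have "Re (of_real pi * w / of_real y) = pi * Re w / y" for w by simp
  hence "Re (of_real pi * (\<epsilon> - \<i> * of_real (of_int m / \<alpha>))\<^sup>2 / of_real y) = - (pi * ((Im \<epsilon> - of_int m / \<alpha>)\<^sup>2 - (Re \<epsilon>)\<^sup>2) / y)"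
    unfolding re[symmetric] by (simp only: re) (simp add: right_diff_distrib diff_divide_distrib)
  moreover have "norm (complex_of_real (\<alpha> * sqrt y)) = \<alpha> * sqrt y" using assms
    unfolding norm_of_real by simp
  ultimately show ?thesis unfolding dual_gauss_def norm_divide norm_exp_eq_Re by simp
qed

lemma gauss_decay:
  assumes "\<alpha> > 0" "y > 0"
  obtains C where "\<And>t. (1 + \<bar>t\<bar>) * norm (gauss \<epsilon> y (of_real (\<alpha> * t))) \<le> C / (1 + t\<^sup>2)"
proof -
  have "pi * y * \<alpha>\<^sup>2 > 0" using assms by simp
  then obtain C where C: "\<And>t. (1 + \<bar>t\<bar>) * exp ((2 * pi * Re \<epsilon> * \<alpha>) * t - (pi * y * \<alpha>\<^sup>2) * t\<^sup>2) \<le> C / (1 + t\<^sup>2)"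
    using gaussian_decay_real[of "pi * y * \<alpha>\<^sup>2" "2 * pi * Re \<epsilon> * \<alpha>"] by metis
  have eq: "2 * pi * Re \<epsilon> * (\<alpha> * t) - pi * y * (\<alpha> * t)\<^sup>2 = (2 * pi * Re \<epsilon> * \<alpha>) * t - (pi * y * \<alpha>\<^sup>2) * t\<^sup>2" for t
    by (simp add: power_mult_distrib)
  show ?thesis by (rule that[of C]) (use C in \<open>simp only: norm_gauss eq\<close>)
qed

lemma dual_gauss_summable:
  assumes "\<alpha> > 0" "y > 0"
  shows "(\<lambda>m. (1 + \<bar>of_int m\<bar>) * norm (dual_gauss \<alpha> \<epsilon> y m)) summable_on UNIV"
proof -
  define a b where "a = pi / (y * \<alpha>\<^sup>2)" and "b = 2 * pi * Im \<epsilon> / (y * \<alpha>)"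
  define K where "K = exp (pi * ((Re \<epsilon>)\<^sup>2 - (Im \<epsilon>)\<^sup>2) / y) / (\<alpha> * sqrt y)"
  have "a > 0" using assms by (simp add: a_def)
  then obtain C where C: "\<And>t. (1 + \<bar>t\<bar>) * exp (b * t - a * t\<^sup>2) \<le> C / (1 + t\<^sup>2)"
    using gaussian_decay_real[of a b] by metis
  have K: "K \<ge> 0" using assms by (simp add: K_def)
  have eq: "norm (dual_gauss \<alpha> \<epsilon> y m) = K * exp (b * of_int m - a * (of_int m)\<^sup>2)" for m
  proof -
    have "- (pi * ((Im \<epsilon> - of_int m / \<alpha>)\<^sup>2 - (Re \<epsilon>)\<^sup>2) / y)
        = pi * ((Re \<epsilon>)\<^sup>2 - (Im \<epsilon>)\<^sup>2) / y + (b * of_int m - a * (of_int m)\<^sup>2)"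
      using assms by (simp add: a_def b_def power2_eq_square field_simps)
    thus ?thesis unfolding norm_dual_gauss[OF assms] by (simp add: exp_add K_def)
  qed
  have "(\<lambda>m::int. (K * C) * (1 / (1 + (of_int m)\<^sup>2))) summable_on UNIV"
    by (intro summable_on_cmult_right summable_on_inverse_squares_int)
  thus ?thesis
  proof (rule summable_on_comparison_test)
    fix m :: int
    show "(1 + \<bar>of_int m\<bar>) * norm (dual_gauss \<alpha> \<epsilon> y m) \<le> (K * C) * (1 / (1 + (of_int m)\<^sup>2))"
      using mult_left_mono[OF C[of "of_int m"] K] by (simp add: eq mult_ac)
  qed auto
qed

lemma gauss_times_cis:
  "gauss \<epsilon> y (of_real (\<alpha> * t)) * cis (- (2 * pi * of_int m * t))
     = exp ((2 * of_real pi * \<epsilon> * of_real \<alpha> - 2 * of_real pi * of_int m * \<i>) * of_real t - of_real ((pi * y * \<alpha>\<^sup>2) * t\<^sup>2))"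
  unfolding gauss_def cis_conv_exp exp_add[symmetric]
  by (rule arg_cong[where f = exp]) (simp add: power_mult_distrib algebra_simps)

lemma continuous_on_gauss [continuous_intros]:
  "continuous_on A f \<Longrightarrow> continuous_on A (\<lambda>t. gauss \<epsilon> y (f t))"
  unfolding gauss_def by (intro continuous_intros)

lemma fourier_coefficient_gauss:
  assumes "\<alpha> > 0" "y > 0"
  shows "(\<lambda>N. integral {- real N..real N} (\<lambda>t. gauss \<epsilon> y (of_real (\<alpha> * t)) * cis (- (2 * pi * of_int m * t))))
           \<longlonglongrightarrow> dual_gauss \<alpha> \<epsilon> y m"
proof (rule tendsto_integral_symmetric_interval)
  define B where "B = 2 * of_real pi * \<epsilon> * of_real \<alpha> - 2 * of_real pi * of_int m * \<i>"
  define A where "A = pi * y * \<alpha>\<^sup>2"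
  have A: "A > 0" using assms by (simp add: A_def)
  have "B = 2 * of_real pi * of_real \<alpha> * (\<epsilon> - \<i> * of_real (of_int m / \<alpha>))"
    using assms by (simp add: B_def field_simps)
  hence "B\<^sup>2 / of_real (4 * A) = of_real pi * (\<epsilon> - \<i> * of_real (of_int m / \<alpha>))\<^sup>2 / of_real y"
    using assms by (simp add: A_def power_mult_distrib power2_eq_square[of "complex_of_real pi"] power2_eq_square[of \<alpha>] power2_eq_square[of "complex_of_real \<alpha>"])
  moreover have "sqrt (pi / A) = 1 / (\<alpha> * sqrt y)"
    using assms by (simp add: A_def real_sqrt_divide real_sqrt_mult)
  ultimately have "of_real (sqrt (pi / A)) * exp (B\<^sup>2 / of_real (4 * A)) = dual_gauss \<alpha> \<epsilon> y m"
    by (simp add: dual_gauss_def)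
  thus "has_bochner_integral lborel (\<lambda>t. gauss \<epsilon> y (of_real (\<alpha> * t)) * cis (- (2 * pi * of_int m * t))) (dual_gauss \<alpha> \<epsilon> y m)"
    using has_bochner_integral_gaussian_complex[OF A, of B]
    unfolding gauss_times_cis B_def[symmetric] A_def[symmetric] by simp
qed (auto intro!: continuous_intros)

lemma gauss_tendsto_0:
  assumes "\<alpha> > 0" "y > 0" 
  shows "(\<lambda>N. gauss \<epsilon> y (of_real (\<alpha> * real N))) \<longlonglongrightarrow> 0" 
    "(\<lambda>N. gauss \<epsilon> y (of_real (\<alpha> * - real N))) \<longlonglongrightarrow> 0"
proof -
  obtain C where C: "\<And>t. (1 + \<bar>t\<bar>) * norm (gauss \<epsilon> y (of_real (\<alpha> * t))) \<le> C / (1 + t\<^sup>2)"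
    by (rule gauss_decay[OF assms, of \<epsilon>]) blast
  have le: "norm (gauss \<epsilon> y (of_real (\<alpha> * t))) \<le> C / (1 + t\<^sup>2)" for t
    by (rule order_trans[OF _ C[of t]]) (auto simp: algebra_simps)
  have lim: "(\<lambda>N. C / (1 + (real N)\<^sup>2)) \<longlonglongrightarrow> 0"
    by (intro real_tendsto_divide_at_top tendsto_const filterlim_tendsto_add_at_top[OF tendsto_const]
          filterlim_pow_at_top filterlim_real_sequentially) auto
  show "(\<lambda>N. gauss \<epsilon> y (of_real (\<alpha> * real N))) \<longlonglongrightarrow> 0"
    by (rule Lim_null_comparison[OF _ lim]) (use le[of "real _"] in simp)
  show "(\<lambda>N. gauss \<epsilon> y (of_real (\<alpha> * - real N))) \<longlonglongrightarrow> 0"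
    by (rule Lim_null_comparison[OF _ lim]) (use le[of "- real _"] in simp)
qed

text \<open>The derivative of \<open>F(t) = exp (Bt - At\<^sup>2)\<close> is \<open>(B - 2At) F(t)\<close> and integrates to \<open>0\<close> over the real
  line, so the integral of \<open>t F(t)\<close> is \<open>B / 2A\<close> times the integral of \<open>F\<close>.\<close>

lemma fourier_coefficient_mult_gauss:
  assumes "\<alpha> > 0" "y > 0"
  shows "(\<lambda>N. integral {- real N..real N} (\<lambda>t. of_real t * gauss \<epsilon> y (of_real (\<alpha> * t)) * cis (- (2 * pi * of_int m * t))))
           \<longlonglongrightarrow> (\<epsilon> - \<i> * of_real (of_int m / \<alpha>)) / of_real (y * \<alpha>) * dual_gauss \<alpha> \<epsilon> y m"
proof -
  define B where "B = 2 * of_real pi * \<epsilon> * of_real \<alpha> - 2 * of_real pi * of_int m * \<i>"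
  define A where "A = pi * y * \<alpha>\<^sup>2"
  have A: "A > 0" using assms by (simp add: A_def)
  define F where "F t = gauss \<epsilon> y (of_real (\<alpha> * t)) * cis (- (2 * pi * of_int m * t))" for t
  have F: "F t = exp (B * of_real t - of_real (A * t\<^sup>2))" for t
    unfolding F_def gauss_times_cis B_def A_def ..
  have contF: "continuous_on S F" for S
    unfolding F_def by (intro continuous_intros)
  have deriv: "(F has_vector_derivative (B - 2 * of_real A * of_real t) * F t) (at t within S)" for t S
  proof -
    have "((\<lambda>z. exp (B * z - of_real A * z\<^sup>2)) has_field_derivative (B - 2 * of_real A * of_real t) * exp (B * of_real t - of_real A * (of_real t)\<^sup>2)) (at (of_real t))"
      by (auto intro!: derivative_eq_intros)
    from has_vector_derivative_real_field[OF this] show ?thesis by (simp add: F[abs_def])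
  qed
  have ftc: "((\<lambda>t. (B - 2 * of_real A * of_real t) * F t) has_integral (F (real N) - F (- real N))) {- real N..real N}" for N
    by (rule fundamental_theorem_of_calculus) (auto intro: deriv)
  have "integral {- real N..real N} (\<lambda>t. of_real t * F t)
      = (B * integral {- real N..real N} F - (F (real N) - F (- real N))) / (2 * of_real A)" for N
  proof -
    have "(F has_integral integral {- real N..real N} F) {- real N..real N}"
      by (intro integrable_integral integrable_continuous_interval contF)
    from has_integral_diff[OF has_integral_mult_right[OF this, of B] ftc[of N]]
    have "((\<lambda>t. (of_real t * F t) * (2 * of_real A)) has_integral (B * integral {- real N..real N} F - (F (real N) - F (- real N)))) {- real N..real N}"
      by (simp add: algebra_simps)
    from has_integral_divide[OF this, of "2 * of_real A"] show ?thesis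
      using A by (intro integral_unique) simp
  qed
  moreover have "(\<lambda>N. (B * integral {- real N..real N} F - (F (real N) - F (- real N))) / (2 * of_real A))
     \<longlonglongrightarrow> (B * dual_gauss \<alpha> \<epsilon> y m - (0 - 0)) / (2 * of_real A)"
  proof (intro tendsto_intros)
    show "(\<lambda>N. integral {- real N..real N} F) \<longlonglongrightarrow> dual_gauss \<alpha> \<epsilon> y m"
      using fourier_coefficient_gauss[OF assms] unfolding F_def .
    show "(\<lambda>N. F (real N)) \<longlonglongrightarrow> 0"
      by (rule tendsto_norm_zero_cancel) (use gauss_tendsto_0(1)[OF assms] in \<open>simp add: F_def norm_mult tendsto_norm_zero_iff\<close>)
    show "(\<lambda>N. F (- real N)) \<longlonglongrightarrow> 0"
      by (rule tendsto_norm_zero_cancel) (use gauss_tendsto_0(2)[OF assms] in \<open>simp add: F_def norm_mult tendsto_norm_zero_iff\<close>)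
  qed (use A in auto)
  moreover have "B / (2 * of_real A) = (\<epsilon> - \<i> * of_real (of_int m / \<alpha>)) / of_real (y * \<alpha>)"
    using assms by (simp add: B_def A_def power2_eq_square field_simps)
  hence "(B * dual_gauss \<alpha> \<epsilon> y m - (0 - 0)) / (2 * of_real A) = (\<epsilon> - \<i> * of_real (of_int m / \<alpha>)) / of_real (y * \<alpha>) * dual_gauss \<alpha> \<epsilon> y m"
    by (metis diff_zero times_divide_eq_left)
  ultimately show ?thesis by (simp add: F_def mult.assoc)
qed

section \<open>Dual series of a Gaussian lattice sum\<close>

lemma gauss_poisson:
  assumes "\<alpha> > 0" "y > 0"
  shows "(\<Sum>\<^sub>\<infinity>v::int. gauss \<epsilon> y (of_real (\<alpha> * (x + of_int v))))
           = (\<Sum>\<^sub>\<infinity>m. dual_gauss \<alpha> \<epsilon> y m * cis (2 * pi * of_int m * x))"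
    and "(\<lambda>v::int. norm (gauss \<epsilon> y (of_real (\<alpha> * (x + of_int v))))) summable_on UNIV"
proof -
  obtain C where C: "\<And>t. (1 + \<bar>t\<bar>) * norm (gauss \<epsilon> y (of_real (\<alpha> * t))) \<le> C / (1 + t\<^sup>2)"
    by (rule gauss_decay[OF assms, of \<epsilon>]) blast
  have le: "norm (gauss \<epsilon> y (of_real (\<alpha> * t))) \<le> C / (1 + t\<^sup>2)" for t
    by (rule order_trans[OF _ C[of t]]) (auto simp: algebra_simps)
  have cont: "continuous_on UNIV (\<lambda>t. gauss \<epsilon> y (of_real (\<alpha> * t)))" by (intro continuous_intros)
  have summ: "(\<lambda>m. norm (dual_gauss \<alpha> \<epsilon> y m)) summable_on UNIV"
    by (rule summable_on_comparison_test[OF dual_gauss_summable[OF assms, of \<epsilon>]]) (auto simp: algebra_simps)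
  note P = poisson_summation[OF cont le fourier_coefficient_gauss[OF assms] summ, of x]
  show "(\<Sum>\<^sub>\<infinity>v::int. gauss \<epsilon> y (of_real (\<alpha> * (x + of_int v)))) = (\<Sum>\<^sub>\<infinity>m. dual_gauss \<alpha> \<epsilon> y m * cis (2 * pi * of_int m * x))"
    "(\<lambda>v::int. norm (gauss \<epsilon> y (of_real (\<alpha> * (x + of_int v))))) summable_on UNIV"
    using P by auto
qed

lemma mult_dual_gauss_bound:
  assumes "\<alpha> > 0"
  shows "norm ((\<epsilon> - \<i> * of_real (of_int m / \<alpha>)) * z) \<le> (norm \<epsilon> + 1 / \<alpha>) * ((1 + \<bar>of_int m\<bar>) * norm z)"
proof -
  have "norm (\<epsilon> - \<i> * of_real (of_int m / \<alpha>)) \<le> norm \<epsilon> + norm (\<i> * complex_of_real (of_int m / \<alpha>))"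
    by (rule norm_triangle_ineq4)
  also have "\<dots> = norm \<epsilon> + \<bar>of_int m\<bar> / \<alpha>"
    using assms by (simp only: norm_mult norm_of_real) (simp add: norm_divide)
  also have "\<dots> \<le> (norm \<epsilon> + 1 / \<alpha>) * (1 + \<bar>of_int m\<bar>)"
    using assms by (simp add: algebra_simps)
  finally have "norm (\<epsilon> - \<i> * of_real (of_int m / \<alpha>)) \<le> (norm \<epsilon> + 1 / \<alpha>) * (1 + \<bar>of_int m\<bar>)" .
  from mult_right_mono[OF this norm_ge_zero[of z]] show ?thesis
    by (simp only: norm_mult mult.assoc)
qed

text \<open>The first moment of the lattice sum is needed because the weights \<open>k + 1\<close> in the characters are
  affine in the exponent.\<close>

lemma mult_gauss_poisson:
  assumes "\<alpha> > 0" "y > 0"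
  shows "(\<Sum>\<^sub>\<infinity>v::int. of_real (x + of_int v) * gauss \<epsilon> y (of_real (\<alpha> * (x + of_int v))))
           = (\<Sum>\<^sub>\<infinity>m. (\<epsilon> - \<i> * of_real (of_int m / \<alpha>)) / of_real (y * \<alpha>) * dual_gauss \<alpha> \<epsilon> y m
                     * cis (2 * pi * of_int m * x))"
    and "(\<lambda>v::int. norm (of_real (x + of_int v) * gauss \<epsilon> y (of_real (\<alpha> * (x + of_int v))))) summable_on UNIV"
proof -
  obtain C where C: "\<And>t. (1 + \<bar>t\<bar>) * norm (gauss \<epsilon> y (of_real (\<alpha> * t))) \<le> C / (1 + t\<^sup>2)"
    by (rule gauss_decay[OF assms, of \<epsilon>]) blast
  have le: "norm (of_real t * gauss \<epsilon> y (of_real (\<alpha> * t))) \<le> C / (1 + t\<^sup>2)" for t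
    by (rule order_trans[OF _ C[of t]]) (auto simp: norm_mult algebra_simps)
  have cont: "continuous_on UNIV (\<lambda>t. of_real t * gauss \<epsilon> y (of_real (\<alpha> * t)))" by (intro continuous_intros)
  have summ: "(\<lambda>m. norm ((\<epsilon> - \<i> * of_real (of_int m / \<alpha>)) / of_real (y * \<alpha>) * dual_gauss \<alpha> \<epsilon> y m)) summable_on UNIV"
  proof (rule summable_on_comparison_test[OF summable_on_cmult_right[OF dual_gauss_summable[OF assms, of \<epsilon>], of "(norm \<epsilon> + 1 / \<alpha>) / (y * \<alpha>)"]])
    fix m
    have "norm ((\<epsilon> - \<i> * of_real (of_int m / \<alpha>)) / of_real (y * \<alpha>) * dual_gauss \<alpha> \<epsilon> y m)
        = norm ((\<epsilon> - \<i> * of_real (of_int m / \<alpha>)) * dual_gauss \<alpha> \<epsilon> y m) / (y * \<alpha>)"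
      using assms by (simp add: norm_mult norm_divide)
    also have "\<dots> \<le> ((norm \<epsilon> + 1 / \<alpha>) * ((1 + \<bar>of_int m\<bar>) * norm (dual_gauss \<alpha> \<epsilon> y m))) / (y * \<alpha>)"
      using assms by (intro divide_right_mono mult_dual_gauss_bound) auto
    finally show "norm ((\<epsilon> - \<i> * of_real (of_int m / \<alpha>)) / of_real (y * \<alpha>) * dual_gauss \<alpha> \<epsilon> y m)
       \<le> (norm \<epsilon> + 1 / \<alpha>) / (y * \<alpha>) * ((1 + \<bar>of_int m\<bar>) * norm (dual_gauss \<alpha> \<epsilon> y m))" by simp
  qed auto
  note P = poisson_summation[OF cont le fourier_coefficient_mult_gauss[OF assms] summ, of x]
  show "(\<Sum>\<^sub>\<infinity>v::int. of_real (x + of_int v) * gauss \<epsilon> y (of_real (\<alpha> * (x + of_int v))))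
           = (\<Sum>\<^sub>\<infinity>m. (\<epsilon> - \<i> * of_real (of_int m / \<alpha>)) / of_real (y * \<alpha>) * dual_gauss \<alpha> \<epsilon> y m
                     * cis (2 * pi * of_int m * x))"
    "(\<lambda>v::int. norm (of_real (x + of_int v) * gauss \<epsilon> y (of_real (\<alpha> * (x + of_int v))))) summable_on UNIV"
    using P by auto
qed

section \<open>Exponential decay of signed lattice sums\<close>

lemma has_sum_finite_combination:
  fixes f :: "'j \<Rightarrow> 'i \<Rightarrow> complex"
  assumes "finite J" "\<And>j. j \<in> J \<Longrightarrow> (f j has_sum s j) A"
  shows "((\<lambda>i. \<Sum>j\<in>J. f j i) has_sum (\<Sum>j\<in>J. s j)) A"
  using assms by (induction J rule: finite_induct) (auto intro!: has_sum_add)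

lemma has_sum_diff_complex:
  fixes f g :: "'i \<Rightarrow> complex"
  assumes "(f has_sum a) A" "(g has_sum b) A"
  shows "((\<lambda>i. f i - g i) has_sum (a - b)) A"
  using has_sum_add[OF assms(1), of "\<lambda>i. - g i" "- b"] assms(2) by (simp add: has_sum_uminus)

text \<open>The \<open>m\<close>-th mode has size \<open>exp (-X/y)\<close> with \<open>X = \<pi> ((Im \<epsilon> - m/\<alpha>)\<^sup>2 - (Re \<epsilon>)\<^sup>2)\<close>, and the gap
  makes all \<open>X\<close> at least some \<open>\<delta> > 0\<close>.  Comparison with \<open>y = 1\<close>, where the modes are summable,
  costs only the factor \<open>exp (\<delta> - \<delta>/y)\<close>.  A power of \<open>y\<close> is extracted from it that is large enough
  to absorb the denominators \<open>sqrt y\<close> of the dual Gaussian and \<open>y\<close> of the first moment.\<close>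

lemma dual_gauss_sum_bound:
  fixes w :: "int \<Rightarrow> complex"
  assumes \<alpha>: "\<alpha> > 0" and L: "\<And>m. norm (w m) \<le> L * (1 + \<bar>of_int m\<bar>)"
    and gap: "\<And>m. w m \<noteq> 0 \<Longrightarrow> \<rho> \<le> \<bar>of_int m / \<alpha> - Im \<epsilon>\<bar>" and \<rho>: "\<bar>Re \<epsilon>\<bar> < \<rho>"
  obtains K where "\<And>y. 0 < y \<Longrightarrow> y \<le> 1 \<Longrightarrow> norm (\<Sum>\<^sub>\<infinity>m. w m * dual_gauss \<alpha> \<epsilon> y m) \<le> K * (y * sqrt y)"
proof -
  define \<delta> where "\<delta> = pi * (\<rho>\<^sup>2 - (Re \<epsilon>)\<^sup>2)"
  have "(Re \<epsilon>)\<^sup>2 < \<rho>\<^sup>2" using \<rho> abs_le_square_iff[of \<rho> "Re \<epsilon>"] by linarith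
  hence \<delta>: "\<delta> > 0" by (simp add: \<delta>_def)
  define b where "b m = (1 + \<bar>of_int m\<bar>) * norm (dual_gauss \<alpha> \<epsilon> 1 m)" for m
  have b: "b summable_on UNIV" unfolding b_def by (rule dual_gauss_summable) (use \<alpha> in auto)
  have L0: "L \<ge> 0" using order_trans[OF norm_ge_zero L[of 0]] by simp
  have bound: "norm (w m * dual_gauss \<alpha> \<epsilon> y m) \<le> (L * (2 * exp \<delta> / \<delta>\<^sup>2) * (y * sqrt y)) * b m"
    if y: "0 < y" "y \<le> 1" for y m
  proof (cases "w m = 0")
    case True
    have "0 \<le> (L * (2 * exp \<delta> / \<delta>\<^sup>2) * (y * sqrt y)) * b m"
      using L0 y by (intro mult_nonneg_nonneg) (auto simp: b_def)
    thus ?thesis using True by simp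
  next
    case False
    define X where "X = pi * ((Im \<epsilon> - of_int m / \<alpha>)\<^sup>2 - (Re \<epsilon>)\<^sup>2)"
    have "\<rho>\<^sup>2 \<le> (Im \<epsilon> - of_int m / \<alpha>)\<^sup>2"
      using gap[OF False] \<rho> by (subst abs_le_square_iff[symmetric]) (simp add: abs_minus_commute)
    hence X: "\<delta> \<le> X" by (simp add: \<delta>_def X_def)
    \<comment> \<open>Here 1/y - 1 is nonnegative because y is at most 1.\<close>
    have "\<delta> * (1 / y - 1) \<le> X * (1 / y - 1)"
      using X y by (intro mult_right_mono) (auto simp: field_simps)
    hence "- (X / y) \<le> - X + (\<delta> - \<delta> / y)" by (simp add: algebra_simps)
    hence "exp (- (X / y)) \<le> exp (- X) * exp (\<delta> - \<delta> / y)"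
      unfolding exp_add[symmetric] by simp
    also have "exp (\<delta> - \<delta> / y) = exp \<delta> / exp (\<delta> / y)" by (rule exp_diff)
    also have "\<dots> \<le> exp \<delta> / ((\<delta> / y)\<^sup>2 / 2)"
    proof (rule divide_left_mono)
      have "0 \<le> \<delta> / y" using \<delta> y by simp
      thus "(\<delta> / y)\<^sup>2 / 2 \<le> exp (\<delta> / y)" using exp_lower_Taylor_quadratic[of "\<delta> / y"] by linarith
    qed (use \<delta> y in auto)
    also have "\<dots> = (2 * exp \<delta> / \<delta>\<^sup>2) * y\<^sup>2" by (simp add: power_divide)
    finally have e: "exp (- (X / y)) \<le> exp (- X) * ((2 * exp \<delta> / \<delta>\<^sup>2) * y\<^sup>2)" by simp
    have "norm (dual_gauss \<alpha> \<epsilon> y m) = exp (- (X / y)) / (\<alpha> * sqrt y)"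
      using norm_dual_gauss[OF \<alpha> y(1), of \<epsilon> m] by (simp add: X_def)
    also have "\<dots> \<le> (exp (- X) * ((2 * exp \<delta> / \<delta>\<^sup>2) * y\<^sup>2)) / (\<alpha> * sqrt y)"
      using \<alpha> y by (intro divide_right_mono e) auto
    also have "\<dots> = (2 * exp \<delta> / \<delta>\<^sup>2) * (y * sqrt y) * (exp (- X) / \<alpha>)"
    proof -
      have "y\<^sup>2 / sqrt y = y * (y / sqrt y)" by (simp add: power2_eq_square)
      also have "y / sqrt y = sqrt y" using y by (intro real_div_sqrt) auto
      finally have "y\<^sup>2 / sqrt y = y * sqrt y" .
      have "(E * (c * y\<^sup>2)) / (\<alpha> * sqrt y) = c * (y\<^sup>2 / sqrt y) * (E / \<alpha>)" for E c
        by (simp add: mult_ac)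
      thus ?thesis by (simp only: \<open>y\<^sup>2 / sqrt y = y * sqrt y\<close>)
    qed
    also have "exp (- X) / \<alpha> = norm (dual_gauss \<alpha> \<epsilon> 1 m)"
      using norm_dual_gauss[OF \<alpha>, of 1 \<epsilon> m] by (simp add: X_def)
    finally have 1: "norm (dual_gauss \<alpha> \<epsilon> y m) \<le> (2 * exp \<delta> / \<delta>\<^sup>2) * (y * sqrt y) * norm (dual_gauss \<alpha> \<epsilon> 1 m)" .
    have "norm (w m * dual_gauss \<alpha> \<epsilon> y m) \<le> (L * (1 + \<bar>of_int m\<bar>)) * ((2 * exp \<delta> / \<delta>\<^sup>2) * (y * sqrt y) * norm (dual_gauss \<alpha> \<epsilon> 1 m))"
      unfolding norm_mult using L0 by (intro mult_mono L 1) auto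
    thus ?thesis by (simp add: b_def mult_ac)
  qed
  show ?thesis
  proof (rule that)
    fix y :: real assume y: "0 < y" "y \<le> 1"
    define C where "C = L * (2 * exp \<delta> / \<delta>\<^sup>2) * (y * sqrt y)"
    have Cb: "(\<lambda>m. C * b m) summable_on UNIV" by (intro summable_on_cmult_right b)
    have abs: "(\<lambda>m. norm (w m * dual_gauss \<alpha> \<epsilon> y m)) summable_on UNIV"
      by (rule summable_on_comparison_test[OF Cb]) (use bound[OF y] in \<open>auto simp: C_def\<close>)
    have "norm (\<Sum>\<^sub>\<infinity>m. w m * dual_gauss \<alpha> \<epsilon> y m) \<le> (\<Sum>\<^sub>\<infinity>m. norm (w m * dual_gauss \<alpha> \<epsilon> y m))"
      by (rule norm_infsum_bound[OF abs])
    also have "\<dots> \<le> (\<Sum>\<^sub>\<infinity>m. C * b m)"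
      by (rule infsum_mono[OF abs Cb]) (use bound[OF y] in \<open>simp add: C_def\<close>)
    also have "\<dots> = C * infsum b UNIV" by (rule infsum_cmult_right')
    also have "\<dots> = (L * (2 * exp \<delta> / \<delta>\<^sup>2) * infsum b UNIV) * (y * sqrt y)" by (simp add: C_def)
    finally show "norm (\<Sum>\<^sub>\<infinity>m. w m * dual_gauss \<alpha> \<epsilon> y m) \<le> (L * (2 * exp \<delta> / \<delta>\<^sup>2) * infsum b UNIV) * (y * sqrt y)" .
  qed
qed

lemma dual_gauss_sum_tendsto_0:
  fixes w :: "int \<Rightarrow> complex"
  assumes \<alpha>: "\<alpha> > 0" and L: "\<And>m. norm (w m) \<le> L * (1 + \<bar>of_int m\<bar>)"
    and gap: "\<And>m. w m \<noteq> 0 \<Longrightarrow> \<rho> \<le> \<bar>of_int m / \<alpha> - Im \<epsilon>\<bar>" and \<rho>: "\<bar>Re \<epsilon>\<bar> < \<rho>"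
  shows "((\<lambda>y. (\<Sum>\<^sub>\<infinity>m. w m * dual_gauss \<alpha> \<epsilon> y m) / of_real y) \<longlongrightarrow> 0) (at_right 0)"
proof -
  obtain K where K: "\<And>y. 0 < y \<Longrightarrow> y \<le> 1 \<Longrightarrow> norm (\<Sum>\<^sub>\<infinity>m. w m * dual_gauss \<alpha> \<epsilon> y m) \<le> K * (y * sqrt y)"
    using dual_gauss_sum_bound[OF assms] by blast
  have "((\<lambda>y. K * sqrt y) \<longlongrightarrow> K * sqrt 0) (at_right 0)"
    by (intro tendsto_intros)
  hence lim: "((\<lambda>y. K * sqrt y) \<longlongrightarrow> 0) (at_right 0)" by simp
  have "eventually (\<lambda>y::real. 0 < y \<and> y \<le> 1) (at_right 0)"
    by (rule eventually_at_rightI[of 0 1]) auto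
  hence "eventually (\<lambda>y. norm ((\<Sum>\<^sub>\<infinity>m. w m * dual_gauss \<alpha> \<epsilon> y m) / of_real y) \<le> K * sqrt y) (at_right 0)"
    by eventually_elim (use K in \<open>auto simp: norm_divide field_simps\<close>)
  thus ?thesis by (rule Lim_null_comparison[OF _ lim])
qed

definition lattice_sum :: "real \<Rightarrow> complex \<Rightarrow> real \<Rightarrow> real \<Rightarrow> complex" where
  "lattice_sum \<alpha> \<epsilon> y x = (\<Sum>\<^sub>\<infinity>v::int. gauss \<epsilon> y (of_real (\<alpha> * (x + of_int v))))"

definition lattice_moment :: "real \<Rightarrow> complex \<Rightarrow> real \<Rightarrow> real \<Rightarrow> complex" where
  "lattice_moment \<alpha> \<epsilon> y x = (\<Sum>\<^sub>\<infinity>v::int. of_real (x + of_int v) * gauss \<epsilon> y (of_real (\<alpha> * (x + of_int v))))"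

lemma norm_sum_cis_le: "norm (\<Sum>j\<in>J. \<kappa> j * cis (\<theta> j)) \<le> (\<Sum>j\<in>J. norm (\<kappa> j))"
  by (rule sum_norm_le) (simp add: norm_mult)

text \<open>After Poisson summation the \<open>m\<close>-th mode carries the factor \<open>\<Sum>j. \<kappa> j * cis (2\<pi>m x j)\<close>; the gap
  is required only for the modes on which this factor is nonzero.\<close>

lemma lattice_sum_combination_tendsto_0:
  fixes \<kappa> :: "'j \<Rightarrow> complex" and x :: "'j \<Rightarrow> real"
  assumes \<alpha>: "\<alpha> > 0" and J: "finite J"
    and gap: "\<And>m. (\<Sum>j\<in>J. \<kappa> j * cis (2 * pi * of_int m * x j)) \<noteq> 0 \<Longrightarrow> \<rho> \<le> \<bar>of_int m / \<alpha> - Im \<epsilon>\<bar>"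
    and \<rho>: "\<bar>Re \<epsilon>\<bar> < \<rho>"
  shows "((\<lambda>y. \<Sum>j\<in>J. \<kappa> j * lattice_sum \<alpha> \<epsilon> y (x j)) \<longlongrightarrow> 0) (at_right 0)"
    and "((\<lambda>y. \<Sum>j\<in>J. \<kappa> j * lattice_moment \<alpha> \<epsilon> y (x j)) \<longlongrightarrow> 0) (at_right 0)"
proof -
  define e where "e m = (\<Sum>j\<in>J. \<kappa> j * cis (2 * pi * of_int m * x j))" for m
  define L where "L = (\<Sum>j\<in>J. norm (\<kappa> j))"
  have e: "norm (e m) \<le> L" for m unfolding e_def L_def by (rule norm_sum_cis_le)
  have L0: "L \<ge> 0" by (simp add: L_def sum_nonneg)
  define w where "w m = (\<epsilon> - \<i> * of_real (of_int m / \<alpha>)) / of_real \<alpha> * e m" for m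
  have T: "(\<Sum>j\<in>J. \<kappa> j * lattice_sum \<alpha> \<epsilon> y (x j)) = (\<Sum>\<^sub>\<infinity>m. e m * dual_gauss \<alpha> \<epsilon> y m)" if y: "y > 0" for y
  proof -
    have "((\<lambda>m. \<Sum>j\<in>J. \<kappa> j * (dual_gauss \<alpha> \<epsilon> y m * cis (2 * pi * of_int m * x j))) has_sum (\<Sum>j\<in>J. \<kappa> j * lattice_sum \<alpha> \<epsilon> y (x j))) UNIV"
    proof (intro has_sum_finite_combination has_sum_cmult_right J)
      fix j
      have "(\<lambda>m. norm (dual_gauss \<alpha> \<epsilon> y m * cis (2 * pi * of_int m * x j))) summable_on UNIV"
        by (rule summable_on_comparison_test[OF dual_gauss_summable[OF \<alpha> y, of \<epsilon>]]) (auto simp: norm_mult algebra_simps)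
      thus "((\<lambda>m. dual_gauss \<alpha> \<epsilon> y m * cis (2 * pi * of_int m * x j)) has_sum lattice_sum \<alpha> \<epsilon> y (x j)) UNIV"
        unfolding lattice_sum_def gauss_poisson(1)[OF \<alpha> y]
        by (rule has_sum_infsum[OF abs_summable_summable])
    qed
    thus ?thesis by (simp add: infsumI e_def sum_distrib_left sum_distrib_right mult_ac)
  qed
  have V: "(\<Sum>j\<in>J. \<kappa> j * lattice_moment \<alpha> \<epsilon> y (x j)) = (\<Sum>\<^sub>\<infinity>m. w m * dual_gauss \<alpha> \<epsilon> y m) / of_real y" if y: "y > 0" for y
  proof -
    define d where "d m = (\<epsilon> - \<i> * of_real (of_int m / \<alpha>)) / of_real (y * \<alpha>) * dual_gauss \<alpha> \<epsilon> y m" for m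
    have "((\<lambda>m. \<Sum>j\<in>J. \<kappa> j * (d m * cis (2 * pi * of_int m * x j))) has_sum (\<Sum>j\<in>J. \<kappa> j * lattice_moment \<alpha> \<epsilon> y (x j))) UNIV"
    proof (intro has_sum_finite_combination has_sum_cmult_right J)
      fix j
      have "(\<lambda>m. norm (d m * cis (2 * pi * of_int m * x j))) summable_on UNIV"
      proof (rule summable_on_comparison_test[OF summable_on_cmult_right[OF dual_gauss_summable[OF \<alpha> y, of \<epsilon>], of "(norm \<epsilon> + 1 / \<alpha>) / (y * \<alpha>)"]])
        fix m
        have "norm (d m * cis (2 * pi * of_int m * x j)) = norm ((\<epsilon> - \<i> * of_real (of_int m / \<alpha>)) * dual_gauss \<alpha> \<epsilon> y m) / (y * \<alpha>)"
          using \<alpha> y by (simp add: d_def norm_mult norm_divide)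
        also have "\<dots> \<le> ((norm \<epsilon> + 1 / \<alpha>) * ((1 + \<bar>of_int m\<bar>) * norm (dual_gauss \<alpha> \<epsilon> y m))) / (y * \<alpha>)"
          using \<alpha> y by (intro divide_right_mono mult_dual_gauss_bound) auto
        finally show "norm (d m * cis (2 * pi * of_int m * x j)) \<le> (norm \<epsilon> + 1 / \<alpha>) / (y * \<alpha>) * ((1 + \<bar>of_int m\<bar>) * norm (dual_gauss \<alpha> \<epsilon> y m))"
          by simp
      qed auto
      thus "((\<lambda>m. d m * cis (2 * pi * of_int m * x j)) has_sum lattice_moment \<alpha> \<epsilon> y (x j)) UNIV"
        unfolding lattice_moment_def mult_gauss_poisson(1)[OF \<alpha> y] d_def
        by (rule has_sum_infsum[OF abs_summable_summable])
    qed
    moreover have "(\<Sum>j\<in>J. \<kappa> j * (d m * cis (2 * pi * of_int m * x j))) = w m * dual_gauss \<alpha> \<epsilon> y m / of_real y" for m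
    proof -
      have "(\<Sum>j\<in>J. \<kappa> j * (d m * cis (2 * pi * of_int m * x j))) = d m * e m"
        by (simp add: e_def sum_distrib_left mult_ac)
      also have "\<dots> = w m * dual_gauss \<alpha> \<epsilon> y m / of_real y" by (simp add: d_def w_def mult_ac)
      finally show ?thesis .
    qed
    ultimately have "((\<lambda>m. w m * dual_gauss \<alpha> \<epsilon> y m / of_real y) has_sum (\<Sum>j\<in>J. \<kappa> j * lattice_moment \<alpha> \<epsilon> y (x j))) UNIV"
      by simp
    from infsumI[OF this] show ?thesis
      by (simp add: divide_inverse infsum_cmult_left')
  qed
  have pos: "eventually (\<lambda>y::real. y > 0) (at_right 0)" by (rule eventually_at_right_less)
  have "((\<lambda>y. (\<Sum>\<^sub>\<infinity>m. w m * dual_gauss \<alpha> \<epsilon> y m) / of_real y) \<longlongrightarrow> 0) (at_right 0)"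
  proof (rule dual_gauss_sum_tendsto_0[OF \<alpha> _ _ \<rho>])
    show "norm (w m) \<le> (norm \<epsilon> + 1 / \<alpha>) / \<alpha> * L * (1 + \<bar>of_int m\<bar>)" for m
    proof -
      have "norm (w m) = norm ((\<epsilon> - \<i> * of_real (of_int m / \<alpha>)) * e m) / \<alpha>"
        using \<alpha> by (simp add: w_def norm_mult norm_divide)
      also have "\<dots> \<le> (norm \<epsilon> + 1 / \<alpha>) * ((1 + \<bar>of_int m\<bar>) * norm (e m)) / \<alpha>"
        using \<alpha> by (intro divide_right_mono mult_dual_gauss_bound) auto
      also have "\<dots> \<le> (norm \<epsilon> + 1 / \<alpha>) * ((1 + \<bar>of_int m\<bar>) * L) / \<alpha>"
        using \<alpha> by (intro divide_right_mono mult_left_mono e) auto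
      finally show ?thesis by (simp add: mult_ac)
    qed
    show "\<rho> \<le> \<bar>of_int m / \<alpha> - Im \<epsilon>\<bar>" if "w m \<noteq> 0" for m
      using that gap[of m] by (auto simp: w_def e_def)
  qed
  thus "((\<lambda>y. \<Sum>j\<in>J. \<kappa> j * lattice_moment \<alpha> \<epsilon> y (x j)) \<longlongrightarrow> 0) (at_right 0)"
    by (rule Lim_transform_eventually) (use pos in \<open>eventually_elim; simp add: V\<close>)
  \<comment> \<open>The estimate carries a division by y, which is undone for the lattice sums themselves.\<close>
  have "((\<lambda>y. of_real y * ((\<Sum>\<^sub>\<infinity>m. e m * dual_gauss \<alpha> \<epsilon> y m) / of_real y)) \<longlongrightarrow> of_real 0 * 0) (at_right 0)"
  proof (intro tendsto_mult tendsto_of_real tendsto_ident_at dual_gauss_sum_tendsto_0[OF \<alpha> _ _ \<rho>])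
    show "norm (e m) \<le> L * (1 + \<bar>of_int m\<bar>)" for m
    proof -
      have "L * 1 \<le> L * (1 + \<bar>of_int m\<bar>)" using L0 by (intro mult_left_mono) auto
      thus ?thesis using e[of m] by linarith
    qed
  qed (use gap in \<open>simp add: e_def\<close>)
  hence "((\<lambda>y. of_real y * ((\<Sum>\<^sub>\<infinity>m. e m * dual_gauss \<alpha> \<epsilon> y m) / of_real y)) \<longlongrightarrow> 0) (at_right 0)" by simp
  thus "((\<lambda>y. \<Sum>j\<in>J. \<kappa> j * lattice_sum \<alpha> \<epsilon> y (x j)) \<longlongrightarrow> 0) (at_right 0)"
    by (rule Lim_transform_eventually) (use pos in \<open>eventually_elim; simp add: T\<close>)
qed

section \<open>Gaussian series over a half line\<close>

lemma suminf_half_of_int_sum: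
  fixes f :: "int \<Rightarrow> complex"
  assumes "(f has_sum S) UNIV"
  shows "(\<Sum>k. f (int k)) = S - (\<Sum>j. f (- 1 - int j))"
    and "summable (\<lambda>k. f (int k))" and "summable (\<lambda>j. f (- 1 - int j))"
proof -
  have half: "((\<lambda>k. f (g k)) has_sum infsum f (range g)) UNIV" if "inj g" for g :: "nat \<Rightarrow> int"
  proof -
    have "f summable_on UNIV" using assms by (rule has_sum_imp_summable)
    hence "f summable_on range g" by (rule summable_on_subset) auto
    hence "(f has_sum infsum f (range g)) (range g)" by (rule has_sum_infsum)
    thus ?thesis using has_sum_reindex[OF that, of f] by (simp add: o_def)
  qed
  have 1: "((\<lambda>k. f (int k)) has_sum infsum f (range int)) UNIV"
    and 2: "((\<lambda>k. f (- 1 - int k)) has_sum infsum f (range (\<lambda>k. - 1 - int k))) UNIV"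
    by (intro half; simp add: inj_on_def)+
  show s: "summable (\<lambda>k. f (int k))" "summable (\<lambda>j. f (- 1 - int j))"
    using has_sum_imp_sums[OF 1] has_sum_imp_sums[OF 2] by (auto simp: sums_iff)
  have "k \<in> range int \<union> range (\<lambda>k. - 1 - int k)" for k
    by (cases k) auto
  hence U: "range int \<union> range (\<lambda>k. - 1 - int k) = UNIV" by blast
  have sm: "f summable_on A" for A
    using has_sum_imp_summable[OF assms] by (rule summable_on_subset) auto
  have "S = infsum f (range int \<union> range (\<lambda>k. - 1 - int k))" using assms by (simp add: U infsumI)
  also have "\<dots> = infsum f (range int) + infsum f (range (\<lambda>k. - 1 - int k))"
    by (rule infsum_Un_disjoint) (auto intro: sm)
  finally show "(\<Sum>k. f (int k)) = S - (\<Sum>j. f (- 1 - int j))"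
    using has_sum_imp_sums[OF 1] has_sum_imp_sums[OF 2] by (simp add: sums_iff)
qed

text \<open>The sign of \<open>\<sigma> * Re \<epsilon>\<close> makes \<open>exp (2\<pi>\<epsilon>\<mu>)\<close> decay geometrically along the progression, and the
  Gaussian factor has norm at most \<open>1\<close>; this dominates the series uniformly in \<open>y\<close>.\<close>

lemma half_sum_tendsto:
  fixes c :: "nat \<Rightarrow> complex" and x :: real
  assumes \<alpha>: "\<alpha> > 0" and c: "\<And>k. norm (c k) \<le> real (Suc k)" and \<sigma>: "\<sigma> * Re \<epsilon> < 0"
  shows "((\<lambda>y. \<Sum>k. c k * gauss \<epsilon> y (of_real (\<alpha> * (x + \<sigma> * real k))))
           \<longlongrightarrow> (\<Sum>k. c k * exp (2 * of_real pi * \<epsilon> * of_real (\<alpha> * (x + \<sigma> * real k))))) (at_right 0)"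
proof -
  define r where "r = exp (2 * pi * Re \<epsilon> * \<alpha> * \<sigma>)"
  define M where "M k = exp (2 * pi * Re \<epsilon> * \<alpha> * x) * (real (Suc k) * r ^ k)" for k
  have "(2 * pi * \<alpha>) * (\<sigma> * Re \<epsilon>) < 0" using \<alpha> by (intro mult_pos_neg[OF _ \<sigma>]) auto
  hence r: "r < 1" "r > 0" by (simp_all add: r_def mult_ac)
  have "summable (\<lambda>k. real (Suc k) * r ^ k)"
    using geometric_deriv_sums[of r] r by (auto simp: sums_iff)
  hence M: "summable M" unfolding M_def by (intro summable_mult)
  have lim: "((\<lambda>y. c k * gauss \<epsilon> y (of_real (\<alpha> * (x + \<sigma> * real k)))) \<longlongrightarrow> c k * exp (2 * of_real pi * \<epsilon> * of_real (\<alpha> * (x + \<sigma> * real k)))) (at_right 0)" for k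
  proof -
    have "((\<lambda>y. c k * exp (2 * of_real pi * \<epsilon> * of_real (\<alpha> * (x + \<sigma> * real k)) - of_real (pi * y) * (of_real (\<alpha> * (x + \<sigma> * real k)))\<^sup>2))
      \<longlongrightarrow> c k * exp (2 * of_real pi * \<epsilon> * of_real (\<alpha> * (x + \<sigma> * real k)) - of_real (pi * 0) * (of_real (\<alpha> * (x + \<sigma> * real k)))\<^sup>2)) (at_right 0)"
      by (intro tendsto_intros)
    thus ?thesis by (simp add: gauss_def)
  qed
  have bound: "norm (c k * gauss \<epsilon> y (of_real (\<alpha> * (x + \<sigma> * real k)))) \<le> M k" if "y > 0" for k y
  proof -
    have "norm (gauss \<epsilon> y (of_real (\<alpha> * (x + \<sigma> * real k)))) \<le> exp (2 * pi * Re \<epsilon> * (\<alpha> * (x + \<sigma> * real k)))"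
      unfolding norm_gauss using that by simp
    also have "\<dots> = exp (2 * pi * Re \<epsilon> * \<alpha> * x) * r ^ k"
      unfolding r_def exp_of_nat_mult[symmetric] exp_add[symmetric] by (simp add: algebra_simps)
    finally have "norm (c k * gauss \<epsilon> y (of_real (\<alpha> * (x + \<sigma> * real k)))) \<le> real (Suc k) * (exp (2 * pi * Re \<epsilon> * \<alpha> * x) * r ^ k)"
      unfolding norm_mult by (intro mult_mono c) auto
    thus ?thesis by (simp add: M_def mult_ac)
  qed
  have "eventually (\<lambda>(k, y). norm (c k * gauss \<epsilon> y (of_real (\<alpha> * (x + \<sigma> * real k)))) \<le> M k) (at_top \<times>\<^sub>F at_right 0)"
    unfolding eventually_prod_filter
    by (intro exI[of _ "\<lambda>_. True"] exI[of _ "\<lambda>y. y > 0"]) (use bound in \<open>auto simp: eventually_at_right_less simp del: of_real_mult of_real_add\<close>)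
  from tannerys_theorem[OF lim this M] show ?thesis by simp
qed

lemma exp_progression:
  fixes \<epsilon> :: complex
  shows
  "exp (2 * of_real pi * \<epsilon> * of_real (\<alpha> * (x + \<sigma> * real k)))
     = exp (2 * of_real pi * \<epsilon> * of_real (\<alpha> * x)) * exp (2 * of_real pi * \<epsilon> * of_real (\<alpha> * \<sigma>)) ^ k"
  unfolding exp_of_nat_mult[symmetric] exp_add[symmetric]
  by (rule arg_cong[where f = exp]) (simp add: algebra_simps)

definition half_sum :: "real \<Rightarrow> complex \<Rightarrow> real \<Rightarrow> real \<Rightarrow> complex" where
  "half_sum \<alpha> \<epsilon> y x = (\<Sum>k. gauss \<epsilon> y (of_real (\<alpha> * (x - real k))))"

definition half_moment :: "real \<Rightarrow> complex \<Rightarrow> real \<Rightarrow> real \<Rightarrow> complex" where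
  "half_moment \<alpha> \<epsilon> y x = (\<Sum>k. of_nat (Suc k) * gauss \<epsilon> y (of_real (\<alpha> * (x - real (Suc k)))))"

text \<open>Twice the hyperbolic sine.  Without the factor \<open>1/2\<close> it is exactly the difference of
  exponentials produced by summing over the shifts.\<close>

definition two_sinh :: "complex \<Rightarrow> complex" where
  "two_sinh w = exp w - exp (- w)"

lemma two_sinh_nonzero: "Re w \<noteq> 0 \<Longrightarrow> two_sinh w \<noteq> 0"
proof
  assume "Re w \<noteq> 0" "two_sinh w = 0"
  hence "norm (exp w) = norm (exp (- w))" by (simp add: two_sinh_def)
  thus False using \<open>Re w \<noteq> 0\<close> by (simp add: norm_exp_eq_Re)
qed

lemma sin_times_i: "sin (\<i> * w) = \<i> / 2 * two_sinh w"
proof -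
  have "\<i> * (\<i> * w) = - w" by (simp flip: mult.assoc)
  thus ?thesis by (simp add: sin_exp_eq two_sinh_def field_simps)
qed

text \<open>The integer \<open>v = -(k + 1)\<close> satisfies \<open>-v = x - (x + v)\<close>, which writes the weight \<open>k + 1\<close> through a lattice
  sum and its first moment.\<close>

lemma lattice_has_sum:
  assumes "\<alpha> > 0" "y > 0"
  shows "((\<lambda>k::int. gauss \<epsilon> y (of_real (\<alpha> * (x - of_int k)))) has_sum lattice_sum \<alpha> \<epsilon> y x) UNIV"
    and "((\<lambda>k::int. of_int (k + 1) * gauss \<epsilon> y (of_real (\<alpha> * (x - of_int (k + 1)))))
           has_sum (of_real x * lattice_sum \<alpha> \<epsilon> y x - lattice_moment \<alpha> \<epsilon> y x)) UNIV"
proof -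
  have T: "((\<lambda>v::int. gauss \<epsilon> y (of_real (\<alpha> * (x + of_int v)))) has_sum lattice_sum \<alpha> \<epsilon> y x) UNIV"
    unfolding lattice_sum_def by (rule has_sum_infsum[OF abs_summable_summable[OF gauss_poisson(2)[OF assms]]])
  have V: "((\<lambda>v::int. of_real (x + of_int v) * gauss \<epsilon> y (of_real (\<alpha> * (x + of_int v)))) has_sum lattice_moment \<alpha> \<epsilon> y x) UNIV"
    unfolding lattice_moment_def by (rule has_sum_infsum[OF abs_summable_summable[OF mult_gauss_poisson(2)[OF assms]]])
  show "((\<lambda>k::int. gauss \<epsilon> y (of_real (\<alpha> * (x - of_int k)))) has_sum lattice_sum \<alpha> \<epsilon> y x) UNIV"
    by (rule has_sum_reindex_bij_witness[of _ "\<lambda>k. - k" "\<lambda>k. - k", THEN iffD2, OF _ _ _ _ _ refl T]) auto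
  have "((\<lambda>v::int. - of_int v * gauss \<epsilon> y (of_real (\<alpha> * (x + of_int v)))) has_sum (of_real x * lattice_sum \<alpha> \<epsilon> y x - lattice_moment \<alpha> \<epsilon> y x)) UNIV"
    using has_sum_diff_complex[OF has_sum_cmult_right[OF T, of "of_real x"] V]
    by (simp add: algebra_simps)
  from this show "((\<lambda>k::int. of_int (k + 1) * gauss \<epsilon> y (of_real (\<alpha> * (x - of_int (k + 1)))))
           has_sum (of_real x * lattice_sum \<alpha> \<epsilon> y x - lattice_moment \<alpha> \<epsilon> y x)) UNIV"
    by (rule has_sum_reindex_bij_witness[of _ "\<lambda>v. - v - 1" "\<lambda>k. - k - 1", THEN iffD2, OF _ _ _ _ _ refl, rotated -1]) (auto simp: algebra_simps)
qed

lemma half_sum_summable: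
  assumes "\<alpha> > 0" "y > 0"
  shows "summable (\<lambda>k. gauss \<epsilon> y (of_real (\<alpha> * (x - real k))))"
    and "summable (\<lambda>k. of_nat (Suc k) * gauss \<epsilon> y (of_real (\<alpha> * (x - real (Suc k)))))"
  using suminf_half_of_int_sum(2)[OF lattice_has_sum(1)[OF assms, of \<epsilon> x]]
    suminf_half_of_int_sum(2)[OF lattice_has_sum(2)[OF assms, of \<epsilon> x]]
  by (simp_all add: add_ac)

text \<open>In the weighted series the term \<open>k = -1\<close> vanishes; the complementary half line therefore starts
  at \<open>\<alpha>x\<close> with weight \<open>0\<close>.\<close>

lemma half_sum_complement:
  assumes "\<alpha> > 0" "y > 0"
  shows "half_sum \<alpha> \<epsilon> y x = lattice_sum \<alpha> \<epsilon> y x - (\<Sum>k. gauss \<epsilon> y (of_real (\<alpha> * ((x + 1) + 1 * real k))))"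
    and "half_moment \<alpha> \<epsilon> y x = (of_real x * lattice_sum \<alpha> \<epsilon> y x - lattice_moment \<alpha> \<epsilon> y x)
            + (\<Sum>k. of_nat k * gauss \<epsilon> y (of_real (\<alpha> * (x + 1 * real k))))"
proof -
  show "half_sum \<alpha> \<epsilon> y x = lattice_sum \<alpha> \<epsilon> y x - (\<Sum>k. gauss \<epsilon> y (of_real (\<alpha> * ((x + 1) + 1 * real k))))"
    using suminf_half_of_int_sum(1)[OF lattice_has_sum(1)[OF assms, of \<epsilon> x]]
    by (simp add: half_sum_def algebra_simps)
  note * = suminf_half_of_int_sum[OF lattice_has_sum(2)[OF assms, of \<epsilon> x]]
  have "half_moment \<alpha> \<epsilon> y x = (of_real x * lattice_sum \<alpha> \<epsilon> y x - lattice_moment \<alpha> \<epsilon> y x)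
      - (\<Sum>k. - (of_nat k * gauss \<epsilon> y (of_real (\<alpha> * (x + 1 * real k)))))"
    using *(1) by (simp add: half_moment_def add_ac)
  also have "(\<Sum>k. - (of_nat k * gauss \<epsilon> y (of_real (\<alpha> * (x + 1 * real k))))) = - (\<Sum>k. of_nat k * gauss \<epsilon> y (of_real (\<alpha> * (x + 1 * real k))))"
  proof (rule suminf_minus)
    show "summable (\<lambda>k. of_nat k * gauss \<epsilon> y (of_real (\<alpha> * (x + 1 * real k))))"
      by (subst summable_minus_iff[symmetric]) (use *(3) in simp)
  qed
  finally show "half_moment \<alpha> \<epsilon> y x = (of_real x * lattice_sum \<alpha> \<epsilon> y x - lattice_moment \<alpha> \<epsilon> y x)
            + (\<Sum>k. of_nat k * gauss \<epsilon> y (of_real (\<alpha> * (x + 1 * real k))))" by simp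
qed

text \<open>With \<open>q = exp (-2w)\<close> of norm less than \<open>1\<close>, the limits are \<open>exp (2wx) / (1 - q)\<close> and
  \<open>exp (2wx) q / (1 - q)\<^sup>2\<close>.\<close>

lemma half_sum_limit_pos:
  assumes \<alpha>: "\<alpha> > 0" and \<epsilon>: "Re \<epsilon> > 0"
  defines "w \<equiv> of_real pi * \<epsilon> * of_real \<alpha>"
  shows "((\<lambda>y. half_sum \<alpha> \<epsilon> y x) \<longlongrightarrow> exp (2 * w * of_real x) * exp w / two_sinh w) (at_right 0)"
    and "((\<lambda>y. half_moment \<alpha> \<epsilon> y x) \<longlongrightarrow> exp (2 * w * of_real x) / (two_sinh w)\<^sup>2) (at_right 0)"
proof -
  define q where "q = exp (- (2 * w))"
  have Rew: "Re w > 0" using \<alpha> \<epsilon> by (simp add: w_def)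
  hence q: "norm q < 1" by (simp add: q_def norm_exp_eq_Re)
  have q1: "1 - q = exp (- w) * two_sinh w"
    by (simp add: q_def two_sinh_def right_diff_distrib flip: exp_add)
  have qe: "exp (2 * of_real pi * \<epsilon> * of_real (\<alpha> * - 1)) = q"
    by (simp add: q_def w_def mult_ac)
  have e: "exp (2 * of_real pi * \<epsilon> * of_real (\<alpha> * (x' + - 1 * real k))) = exp (2 * w * of_real x') * q ^ k" for x' k
    unfolding exp_progression qe by (simp add: w_def mult_ac)
  have "((\<lambda>y. \<Sum>k. 1 * gauss \<epsilon> y (of_real (\<alpha> * (x + - 1 * real k)))) \<longlongrightarrow> (\<Sum>k. 1 * (exp (2 * w * of_real x) * q ^ k))) (at_right 0)"
    unfolding e[symmetric] by (rule half_sum_tendsto) (use \<alpha> \<epsilon> in auto)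
  also have "(\<Sum>k. 1 * (exp (2 * w * of_real x) * q ^ k)) = exp (2 * w * of_real x) * (1 / (1 - q))"
    using geometric_sums[OF q] by (simp add: suminf_mult sums_iff)
  also have "\<dots> = exp (2 * w * of_real x) * exp w / two_sinh w"
    unfolding q1 by (simp add: exp_minus field_simps)
  finally show "((\<lambda>y. half_sum \<alpha> \<epsilon> y x) \<longlongrightarrow> exp (2 * w * of_real x) * exp w / two_sinh w) (at_right 0)"
    by (simp add: half_sum_def)
  have "((\<lambda>y. \<Sum>k. of_nat (Suc k) * gauss \<epsilon> y (of_real (\<alpha> * ((x - 1) + - 1 * real k)))) \<longlongrightarrow> (\<Sum>k. of_nat (Suc k) * (exp (2 * w * of_real (x - 1)) * q ^ k))) (at_right 0)"
    unfolding e[symmetric] by (rule half_sum_tendsto) (use \<alpha> \<epsilon> in \<open>auto simp: norm_of_nat simp del: of_nat_Suc\<close>)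
  also have "(\<Sum>k. of_nat (Suc k) * (exp (2 * w * of_real (x - 1)) * q ^ k)) = exp (2 * w * of_real (x - 1)) * (1 / (1 - q)\<^sup>2)"
  proof -
    have "(\<lambda>k. exp (2 * w * of_real (x - 1)) * (of_nat (Suc k) * q ^ k)) sums (exp (2 * w * of_real (x - 1)) * (1 / (1 - q)\<^sup>2))"
      by (intro sums_mult geometric_deriv_sums q)
    thus ?thesis by (simp only: mult.left_commute[of "of_nat _"] sums_iff)
  qed
  also have "exp (2 * w * of_real (x - 1)) = exp (2 * w * of_real x) * (exp (- w))\<^sup>2"
    by (simp add: power2_eq_square algebra_simps flip: exp_add)
  also have "exp (2 * w * of_real x) * (exp (- w))\<^sup>2 * (1 / (1 - q)\<^sup>2) = exp (2 * w * of_real x) / (two_sinh w)\<^sup>2"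
    unfolding q1 power_mult_distrib by simp
  finally show "((\<lambda>y. half_moment \<alpha> \<epsilon> y x) \<longlongrightarrow> exp (2 * w * of_real x) / (two_sinh w)\<^sup>2) (at_right 0)"
    by (simp add: half_moment_def algebra_simps)
qed

text \<open>The limits agree with those for \<open>Re \<epsilon> > 0\<close>: expanding the rational functions \<open>1 / (1 - 1/q)\<close> and
  \<open>(1/q) / (1 - 1/q)\<^sup>2\<close> in powers of \<open>q = exp (2w)\<close> gives the series over the complementary half
  line, with the opposite sign in the first case and the same sign in the second; both match the
  signs in the complement formula.\<close>

lemma half_sum_limit_neg:
  assumes \<alpha>: "\<alpha> > 0" and \<epsilon>: "Re \<epsilon> < 0"
  defines "w \<equiv> of_real pi * \<epsilon> * of_real \<alpha>"
  shows "((\<lambda>y. half_sum \<alpha> \<epsilon> y x - lattice_sum \<alpha> \<epsilon> y x) \<longlongrightarrow> exp (2 * w * of_real x) * exp w / two_sinh w) (at_right 0)"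
    and "((\<lambda>y. half_moment \<alpha> \<epsilon> y x - (of_real x * lattice_sum \<alpha> \<epsilon> y x - lattice_moment \<alpha> \<epsilon> y x))
           \<longlongrightarrow> exp (2 * w * of_real x) / (two_sinh w)\<^sup>2) (at_right 0)"
proof -
  define q where "q = exp (2 * w)"
  have "Re w < 0" using \<alpha> \<epsilon> by (simp add: w_def mult_pos_neg mult_neg_pos)
  hence q: "norm q < 1" by (simp add: q_def norm_exp_eq_Re)
  have q1: "1 - q = - (exp w * two_sinh w)"
    by (simp add: q_def two_sinh_def right_diff_distrib flip: exp_add)
  have q2: "q = (exp w)\<^sup>2" by (simp add: q_def power2_eq_square flip: exp_add)
  have qe: "exp (2 * of_real pi * \<epsilon> * of_real (\<alpha> * 1)) = q"
    by (simp add: q_def w_def mult_ac)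
  have e: "exp (2 * of_real pi * \<epsilon> * of_real (\<alpha> * (x' + 1 * real k))) = exp (2 * w * of_real x') * q ^ k" for x' k
    unfolding exp_progression qe by (simp add: w_def mult_ac)
  have pos: "eventually (\<lambda>y::real. y > 0) (at_right 0)" by (rule eventually_at_right_less)
  have "((\<lambda>y. \<Sum>k. 1 * gauss \<epsilon> y (of_real (\<alpha> * ((x + 1) + 1 * real k)))) \<longlongrightarrow> (\<Sum>k. 1 * (exp (2 * w * of_real (x + 1)) * q ^ k))) (at_right 0)"
    unfolding e[symmetric] by (rule half_sum_tendsto) (use \<alpha> \<epsilon> in auto)
  also have "(\<Sum>k. 1 * (exp (2 * w * of_real (x + 1)) * q ^ k)) = exp (2 * w * of_real (x + 1)) * (1 / (1 - q))"
    using geometric_sums[OF q] by (simp add: suminf_mult sums_iff)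
  also have "exp (2 * w * of_real (x + 1)) = exp (2 * w * of_real x) * q"
    by (simp add: q_def algebra_simps flip: exp_add)
  also have "exp (2 * w * of_real x) * q * (1 / (1 - q)) = - (exp (2 * w * of_real x) * exp w / two_sinh w)"
    unfolding q1 unfolding q2 by (simp add: power2_eq_square)
  finally have "((\<lambda>y. - (\<Sum>k. 1 * gauss \<epsilon> y (of_real (\<alpha> * ((x + 1) + 1 * real k))))) \<longlongrightarrow> - (- (exp (2 * w * of_real x) * exp w / two_sinh w))) (at_right 0)"
    by (rule tendsto_minus)
  hence "((\<lambda>y. - (\<Sum>k. gauss \<epsilon> y (of_real (\<alpha> * ((x + 1) + 1 * real k))))) \<longlongrightarrow> exp (2 * w * of_real x) * exp w / two_sinh w) (at_right 0)"
    by simp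
  thus "((\<lambda>y. half_sum \<alpha> \<epsilon> y x - lattice_sum \<alpha> \<epsilon> y x) \<longlongrightarrow> exp (2 * w * of_real x) * exp w / two_sinh w) (at_right 0)"
    by (rule Lim_transform_eventually) (use pos in eventually_elim, simp only: half_sum_complement(1)[OF \<alpha>], simp)
  have "((\<lambda>y. \<Sum>k. of_nat k * gauss \<epsilon> y (of_real (\<alpha> * (x + 1 * real k)))) \<longlongrightarrow> (\<Sum>k. of_nat k * (exp (2 * w * of_real x) * q ^ k))) (at_right 0)"
    unfolding e[symmetric] by (rule half_sum_tendsto) (use \<alpha> \<epsilon> in auto)
  also have "(\<Sum>k. of_nat k * (exp (2 * w * of_real x) * q ^ k)) = exp (2 * w * of_real x) * (q * (1 / (1 - q)\<^sup>2))"
  proof -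
    have "(\<lambda>k. q * (of_nat (Suc k) * q ^ k)) sums (q * (1 / (1 - q)\<^sup>2))"
      by (intro sums_mult geometric_deriv_sums q)
    hence "(\<lambda>k. of_nat (Suc k) * q ^ Suc k) sums (q * (1 / (1 - q)\<^sup>2))"
      by (simp only: power_Suc mult.left_commute[of q])
    hence "(\<lambda>k. of_nat k * q ^ k) sums (q * (1 / (1 - q)\<^sup>2))"
      by (subst (asm) sums_Suc_iff) simp
    from sums_mult[OF this, of "exp (2 * w * of_real x)"] show ?thesis
      by (simp only: mult.left_commute[of "of_nat _"] sums_iff)
  qed
  also have "exp (2 * w * of_real x) * (q * (1 / (1 - q)\<^sup>2)) = exp (2 * w * of_real x) / (two_sinh w)\<^sup>2"
    unfolding q1 unfolding q2 by (simp add: power_mult_distrib)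
  finally show "((\<lambda>y. half_moment \<alpha> \<epsilon> y x - (of_real x * lattice_sum \<alpha> \<epsilon> y x - lattice_moment \<alpha> \<epsilon> y x))
           \<longlongrightarrow> exp (2 * w * of_real x) / (two_sinh w)\<^sup>2) (at_right 0)"
    by (rule Lim_transform_eventually) (use pos in eventually_elim, simp only: half_sum_complement(2)[OF \<alpha>], simp)
qed

text \<open>All shifts contribute the same phase to the mode \<open>m\<close>, which therefore factors out of the sum of
  the coefficients.\<close>

lemma common_phase:
  assumes "\<And>i j. i \<in> J \<Longrightarrow> j \<in> J \<Longrightarrow> of_int m * (x i - x j) \<in> \<int>" and "(\<Sum>j\<in>J. \<kappa> j) = (0::complex)"
  shows "(\<Sum>j\<in>J. \<kappa> j * cis (2 * pi * of_int m * x j)) = 0"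
proof (cases "J = {}")
  case False
  then obtain i where i: "i \<in> J" by blast
  have "cis (2 * pi * of_int m * x j) = cis (2 * pi * of_int m * x i)" if "j \<in> J" for j
  proof -
    have "cis (2 * pi * of_int m * x j) = cis (2 * pi * of_int m * x i) * cis (2 * pi * (of_int m * (x j - x i)))"
      by (simp add: cis_mult algebra_simps)
    also have "cis (2 * pi * (of_int m * (x j - x i))) = 1"
      by (rule cis_multiple_2pi) (rule assms(1)[OF that i])
    finally show ?thesis by simp
  qed
  hence "(\<Sum>j\<in>J. \<kappa> j * cis (2 * pi * of_int m * x j)) = (\<Sum>j\<in>J. \<kappa> j) * cis (2 * pi * of_int m * x i)"
    by (simp add: sum_distrib_right)
  thus ?thesis using assms(2) by simp
qed simp

text \<open>The hypotheses on the shifts and on the coefficients make the modes divisible by \<open>P\<close> cancel.  For the weighted series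
  the lattice sums occur with coefficients \<open>\<kappa> j * x j\<close> and the first moments with coefficients \<open>\<kappa> j\<close>,
  so both families of coefficients have to sum to zero.\<close>

lemma half_sum_combination_limit:
  fixes \<kappa> :: "'j \<Rightarrow> complex" and x :: "'j \<Rightarrow> real" and P :: int
  assumes \<alpha>: "\<alpha> > 0" and J: "finite J" and \<epsilon>: "Re \<epsilon> \<noteq> 0"
    and gap: "Re \<epsilon> < 0 \<Longrightarrow> \<exists>\<rho>. \<bar>Re \<epsilon>\<bar> < \<rho> \<and> (\<forall>m. \<not> P dvd m \<longrightarrow> \<rho> \<le> \<bar>of_int m / \<alpha> - Im \<epsilon>\<bar>)"
    and phase: "\<And>m i j. P dvd m \<Longrightarrow> i \<in> J \<Longrightarrow> j \<in> J \<Longrightarrow> of_int m * (x i - x j) \<in> \<int>"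
    and \<kappa>0: "(\<Sum>j\<in>J. \<kappa> j) = 0"
  defines "w \<equiv> of_real pi * \<epsilon> * of_real \<alpha>"
  shows "((\<lambda>y. \<Sum>j\<in>J. \<kappa> j * half_sum \<alpha> \<epsilon> y (x j))
           \<longlongrightarrow> (\<Sum>j\<in>J. \<kappa> j * exp (2 * w * of_real (x j))) * exp w / two_sinh w) (at_right 0)"
    and "(\<Sum>j\<in>J. \<kappa> j * of_real (x j)) = 0 \<Longrightarrow>
         ((\<lambda>y. \<Sum>j\<in>J. \<kappa> j * half_moment \<alpha> \<epsilon> y (x j))
           \<longlongrightarrow> (\<Sum>j\<in>J. \<kappa> j * exp (2 * w * of_real (x j))) / (two_sinh w)\<^sup>2) (at_right 0)"
proof -
  have R0: "(\<Sum>j\<in>J. \<kappa> j * exp (2 * w * of_real (x j))) * exp w / two_sinh w = (\<Sum>j\<in>J. \<kappa> j * (exp (2 * w * of_real (x j)) * exp w / two_sinh w))"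
    and R1: "(\<Sum>j\<in>J. \<kappa> j * exp (2 * w * of_real (x j))) / (two_sinh w)\<^sup>2 = (\<Sum>j\<in>J. \<kappa> j * (exp (2 * w * of_real (x j)) / (two_sinh w)\<^sup>2))"
    by (simp_all add: sum_distrib_right sum_divide_distrib mult.assoc)
  have "((\<lambda>y. \<Sum>j\<in>J. \<kappa> j * half_sum \<alpha> \<epsilon> y (x j)) \<longlongrightarrow> (\<Sum>j\<in>J. \<kappa> j * (exp (2 * w * of_real (x j)) * exp w / two_sinh w))) (at_right 0) \<and>
    ((\<Sum>j\<in>J. \<kappa> j * of_real (x j)) = 0 \<longrightarrow> ((\<lambda>y. \<Sum>j\<in>J. \<kappa> j * half_moment \<alpha> \<epsilon> y (x j)) \<longlongrightarrow> (\<Sum>j\<in>J. \<kappa> j * (exp (2 * w * of_real (x j)) / (two_sinh w)\<^sup>2))) (at_right 0))"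
  proof (cases "Re \<epsilon> > 0")
    case True
    show ?thesis unfolding w_def
      by (intro conjI impI tendsto_sum tendsto_mult tendsto_const half_sum_limit_pos[OF \<alpha> True])
  next
    case False
    with \<epsilon> have neg: "Re \<epsilon> < 0" by simp
    obtain \<rho> where \<rho>: "\<bar>Re \<epsilon>\<bar> < \<rho>" "\<And>m. \<not> P dvd m \<Longrightarrow> \<rho> \<le> \<bar>of_int m / \<alpha> - Im \<epsilon>\<bar>"
      using gap[OF neg] by blast
    have gap': "\<rho> \<le> \<bar>of_int m / \<alpha> - Im \<epsilon>\<bar>" if "(\<Sum>j\<in>J. c j * cis (2 * pi * of_int m * x j)) \<noteq> 0" "(\<Sum>j\<in>J. c j) = 0" for c m
      using that common_phase[of J m x c] phase[of m] by (intro \<rho>(2)) blast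
    note lim = lattice_sum_combination_tendsto_0[OF \<alpha> J _ \<rho>(1), where x = x]
    \<comment> \<open>The lattice sums vanish in the limit only in combination; a single one may grow exponentially.\<close>
    have "((\<lambda>y. (\<Sum>j\<in>J. \<kappa> j * lattice_sum \<alpha> \<epsilon> y (x j)) + (\<Sum>j\<in>J. \<kappa> j * (half_sum \<alpha> \<epsilon> y (x j) - lattice_sum \<alpha> \<epsilon> y (x j)))) \<longlongrightarrow> 0 + (\<Sum>j\<in>J. \<kappa> j * (exp (2 * w * of_real (x j)) * exp w / two_sinh w))) (at_right 0)"
      unfolding w_def
      by (intro tendsto_add tendsto_sum tendsto_mult tendsto_const half_sum_limit_neg[OF \<alpha> neg] lim(1) gap'[OF _ \<kappa>0])
    hence 1: "((\<lambda>y. \<Sum>j\<in>J. \<kappa> j * half_sum \<alpha> \<epsilon> y (x j)) \<longlongrightarrow> (\<Sum>j\<in>J. \<kappa> j * (exp (2 * w * of_real (x j)) * exp w / two_sinh w))) (at_right 0)"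
      by (simp add: sum.distrib[symmetric] distrib_left[symmetric])
    have 2: "((\<lambda>y. \<Sum>j\<in>J. \<kappa> j * half_moment \<alpha> \<epsilon> y (x j)) \<longlongrightarrow> (\<Sum>j\<in>J. \<kappa> j * (exp (2 * w * of_real (x j)) / (two_sinh w)\<^sup>2))) (at_right 0)"
      if \<kappa>1: "(\<Sum>j\<in>J. \<kappa> j * of_real (x j)) = 0"
    proof -
      have "((\<lambda>y. ((\<Sum>j\<in>J. (\<kappa> j * of_real (x j)) * lattice_sum \<alpha> \<epsilon> y (x j)) - (\<Sum>j\<in>J. \<kappa> j * lattice_moment \<alpha> \<epsilon> y (x j)))
          + (\<Sum>j\<in>J. \<kappa> j * (half_moment \<alpha> \<epsilon> y (x j) - (of_real (x j) * lattice_sum \<alpha> \<epsilon> y (x j) - lattice_moment \<alpha> \<epsilon> y (x j)))))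
          \<longlongrightarrow> (0 - 0) + (\<Sum>j\<in>J. \<kappa> j * (exp (2 * w * of_real (x j)) / (two_sinh w)\<^sup>2))) (at_right 0)"
        unfolding w_def
        by (intro tendsto_add tendsto_diff tendsto_sum tendsto_mult[of "\<lambda>_. \<kappa> _"] tendsto_const half_sum_limit_neg[OF \<alpha> neg] lim gap'[OF _ \<kappa>0] gap'[OF _ \<kappa>1])
      thus ?thesis
        by (simp add: sum.distrib[symmetric] sum_subtractf[symmetric] right_diff_distrib mult.assoc)
    qed
    show ?thesis using 1 2 by blast
  qed
  thus "((\<lambda>y. \<Sum>j\<in>J. \<kappa> j * half_sum \<alpha> \<epsilon> y (x j))
           \<longlongrightarrow> (\<Sum>j\<in>J. \<kappa> j * exp (2 * w * of_real (x j))) * exp w / two_sinh w) (at_right 0)"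
    "(\<Sum>j\<in>J. \<kappa> j * of_real (x j)) = 0 \<Longrightarrow>
         ((\<lambda>y. \<Sum>j\<in>J. \<kappa> j * half_moment \<alpha> \<epsilon> y (x j))
           \<longlongrightarrow> (\<Sum>j\<in>J. \<kappa> j * exp (2 * w * of_real (x j))) / (two_sinh w)\<^sup>2) (at_right 0)"
    unfolding R0 R1 by blast+
qed

section \<open>Characters on the imaginary axis\<close>

lemma alpha_full_pos: "pp \<ge> 2 \<Longrightarrow> pm \<ge> 2 \<Longrightarrow> alpha_full pp pm > 0"
  by (simp add: alpha_full_def)

lemma sqrt_quotient_eq_alpha_full:
  assumes "pp \<ge> 2" "pm \<ge> 2"
  shows "sqrt (2 * of_int pm / of_int pp) = alpha_full pp pm / of_int pp"
    and "sqrt (2 * of_int pp / of_int pm) = alpha_full pp pm / of_int pm"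
proof -
  have *: "sqrt (2 * b / a) = sqrt (2 * a * b) / a" if "a > 0" "b > 0" for a b :: real
  proof -
    have "2 * b / a = (2 * a * b) / a\<^sup>2" using that by (simp add: power2_eq_square)
    thus ?thesis using that by (simp add: real_sqrt_divide)
  qed
  show "sqrt (2 * of_int pm / of_int pp) = alpha_full pp pm / of_int pp"
    using *[of "of_int pp" "of_int pm"] assms by (simp add: alpha_full_def)
  show "sqrt (2 * of_int pp / of_int pm) = alpha_full pp pm / of_int pm"
    using *[of "of_int pm" "of_int pp"] assms by (simp add: alpha_full_def mult_ac)
qed

lemma centred_weight:
  assumes "pp \<ge> 2" "pm \<ge> 2"
  shows "alpha_weight pp pm r s n - alpha_zero pp pm / 2
           = alpha_full pp pm * ((of_int n - of_int r / of_int pp + of_int s / of_int pm) / 2)"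
proof -
  have "(1 - a) / 2 * (A / p) + (1 - b) / 2 * - (A / q) + c / 2 * A - (A / p + - (A / q)) / 2
      = A * ((c - a / p + b / q) / 2)" for A a b c p q :: real
    by (simp add: algebra_simps diff_divide_distrib add_divide_distrib)
  thus ?thesis
    unfolding alpha_weight_def alpha_zero_def alpha_plus_def alpha_minus_def
      sqrt_quotient_eq_alpha_full[OF assms] .
qed

lemma ch_fock_imaginary:
  "ch_fock pp pm \<epsilon> lam (\<i> * of_real y)
     = gauss \<epsilon> y (lam - of_real (alpha_zero pp pm) / 2) / dedekind_eta (\<i> * of_real y)"
proof -
  have "2 * of_real pi * \<i> * (\<i> * of_real y) * (\<mu>\<^sup>2 / 2) = - (of_real (pi * y) * \<mu>\<^sup>2)" for \<mu> :: complex
    by (simp add: mult.assoc)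
  hence "exp (2 * of_real pi * \<epsilon> * \<mu>) * qpow (\<i> * of_real y) (\<mu>\<^sup>2 / 2) = gauss \<epsilon> y \<mu>" for \<mu>
    by (simp only: qpow_def gauss_def diff_conv_add_uminus exp_add)
  thus ?thesis by (simp add: ch_fock_def)
qed

lemma ch_fock_rsn_imaginary:
  assumes "pp \<ge> 2" "pm \<ge> 2"
    and "(of_int n - of_int r / of_int pp + of_int s / of_int pm) / 2 = x"
  shows "ch_fock_rsn pp pm \<epsilon> r s n (\<i> * of_real y)
     = gauss \<epsilon> y (of_real (alpha_full pp pm * x)) / dedekind_eta (\<i> * of_real y)"
proof -
  have "alpha_full pp pm * x = alpha_weight pp pm r s n - alpha_zero pp pm / 2"
    using centred_weight[OF assms(1,2), of r s n] assms(3) by simp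
  thus ?thesis unfolding ch_fock_rsn_def ch_fock_imaginary by simp
qed

lemma dedekind_eta_nonzero:
  assumes "y > 0"
  shows "dedekind_eta (\<i> * of_real y) \<noteq> 0"
proof -
  define q where "q = exp (- (2 * pi * y))"
  have q: "0 < q" "q < 1" using assms by (simp_all add: q_def)
  have qpow: "qpow (\<i> * of_real y) (of_nat (Suc n)) = of_real (q ^ Suc n)" for n
  proof -
    have "2 * of_real pi * \<i> * (\<i> * of_real y) * of_nat (Suc n) = complex_of_real (of_nat (Suc n) * (- (2 * pi * y)))"
      by (simp add: algebra_simps)
    thus ?thesis unfolding qpow_def q_def exp_of_nat_mult[symmetric] by (simp only: exp_of_real)
  qed
  have "summable (\<lambda>n. q ^ Suc n)" using q by (simp add: summable_geometric)
  hence "abs_convergent_prod (\<lambda>n. 1 - complex_of_real (q ^ Suc n))"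
    unfolding abs_convergent_prod_conv_summable using q by (simp add: norm_power norm_mult)
  hence "convergent_prod (\<lambda>n. 1 - complex_of_real (q ^ Suc n))"
    by (rule abs_convergent_prod_imp_convergent_prod)
  moreover have "1 - complex_of_real (q ^ Suc n) \<noteq> 0" for n
  proof -
    have "q ^ Suc n < 1" using q by (intro power_Suc_less_one) auto
    hence "complex_of_real (q ^ Suc n) \<noteq> 1" by (simp only: of_real_eq_1_iff)
    thus ?thesis by (metis right_minus_eq)
  qed
  ultimately have "(\<Prod>n. 1 - complex_of_real (q ^ Suc n)) \<noteq> 0" by (rule prodinf_nonzero)
  thus ?thesis unfolding dedekind_eta_def qpow by (simp add: qpow_def)
qed

text \<open>The quadratic form of the theta function is that of the lattice \<open>\<alpha>(x + \<int>)\<close> because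
  \<open>\<alpha>\<^sup>2 = 2 p\<^sub>+ p\<^sub>-\<close>.\<close>

lemma theta_imaginary:
  assumes "pp \<ge> 2" "pm \<ge> 2"
  shows "theta (pp * pm) b (\<i> * of_real y) = lattice_sum (alpha_full pp pm) 0 y (of_int b / (2 * of_int (pp * pm)))"
proof -
  have "qpow (\<i> * of_real y) (of_int (pp * pm) * (of_int k + of_int b / (2 * of_int (pp * pm)))\<^sup>2)
      = gauss 0 y (of_real (alpha_full pp pm * (of_int b / (2 * of_int (pp * pm)) + of_int k)))" for k
  proof -
    define u :: real where "u = of_int b / (2 * of_int (pp * pm)) + of_int k"
    have "(alpha_full pp pm)\<^sup>2 = 2 * of_int (pp * pm)" using assms by (simp add: alpha_full_def)
    hence eq: "- (pi * y * (alpha_full pp pm * u)\<^sup>2) = - (2 * pi * y * (of_int (pp * pm) * u\<^sup>2))"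
      by (simp add: power_mult_distrib)
    have "gauss 0 y (of_real v) = exp (of_real (- (pi * y * v\<^sup>2)))" for v
      by (simp add: gauss_def)
    hence "gauss 0 y (of_real (alpha_full pp pm * u)) = exp (of_real (- (2 * pi * y * (of_int (pp * pm) * u\<^sup>2))))"
      by (simp only: eq)
    also have "of_real (- (2 * pi * y * (of_int (pp * pm) * u\<^sup>2)))
       = 2 * of_real pi * \<i> * (\<i> * of_real y) * (of_int (pp * pm) * (of_real u)\<^sup>2)"
      by (simp add: algebra_simps)
    also have "complex_of_real u = of_int k + of_int b / (2 * of_int (pp * pm))" by (simp add: u_def)
    finally show ?thesis by (simp add: qpow_def u_def)
  qed
  thus ?thesis by (simp add: theta_def lattice_sum_def)
qed

text \<open>The two theta functions have the same zeroth mode.  At \<open>\<epsilon> = 0\<close> every other mode has distance at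
  least \<open>1/\<alpha>\<close> from the origin.\<close>

lemma ch_minimal_vanishes:
  assumes "pp \<ge> 2" "pm \<ge> 2"
  shows "((\<lambda>y::real. dedekind_eta (\<i> * of_real y) * ch_minimal pp pm r s (\<i> * of_real y)) \<longlongrightarrow> 0) (at_right 0)"
proof -
  let ?\<alpha> = "alpha_full pp pm"
  \<comment> \<open>The shifts of the two theta functions differ by s/pm.\<close>
  define x :: "int \<Rightarrow> real" where "x j = of_int (r * pm - s * pp) / (2 * of_int (pp * pm)) + of_int j * (of_int s / of_int pm)" for j
  define \<kappa> :: "int \<Rightarrow> complex" where "\<kappa> j = 1 - 2 * of_int j" for j
  have \<alpha>: "?\<alpha> > 0" by (rule alpha_full_pos[OF assms])
  have x1: "x 1 = of_int (r * pm + s * pp) / (2 * of_int (pp * pm))"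
    using assms by (simp add: x_def field_simps)
  have "((\<lambda>y. \<Sum>j\<in>{0,1}. \<kappa> j * lattice_sum ?\<alpha> 0 y (x j)) \<longlongrightarrow> 0) (at_right 0)"
  proof (rule lattice_sum_combination_tendsto_0(1)[OF \<alpha>, where \<rho> = "1 / ?\<alpha>"])
    fix m :: int assume nz: "(\<Sum>j\<in>{0,1}. \<kappa> j * cis (2 * pi * of_int m * x j)) \<noteq> 0"
    have "m \<noteq> 0"
    proof
      assume "m = 0"
      with nz show False by (simp add: \<kappa>_def)
    qed
    hence "1 \<le> \<bar>m\<bar>" by simp
    hence "1 \<le> \<bar>of_int m :: real\<bar>" by (metis of_int_abs of_int_1_le_iff)
    thus "1 / ?\<alpha> \<le> \<bar>of_int m / ?\<alpha> - Im 0\<bar>" using \<alpha> by (simp add: divide_right_mono)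
  qed (use \<alpha> in auto)
  hence lim: "((\<lambda>y. lattice_sum ?\<alpha> 0 y (x 0) - lattice_sum ?\<alpha> 0 y (x 1)) \<longlongrightarrow> 0) (at_right 0)"
    by (simp add: \<kappa>_def)
  have "eventually (\<lambda>y::real. y > 0) (at_right 0)" by (rule eventually_at_right_less)
  hence "eventually (\<lambda>y. lattice_sum ?\<alpha> 0 y (x 0) - lattice_sum ?\<alpha> 0 y (x 1)
     = dedekind_eta (\<i> * of_real y) * ch_minimal pp pm r s (\<i> * of_real y)) (at_right 0)"
  proof eventually_elim
    case (elim y)
    show ?case using dedekind_eta_nonzero[OF elim] unfolding ch_minimal_def theta_imaginary[OF assms] x1
      by (simp add: x_def)
  qed
  with lim show ?thesis by (rule Lim_transform_eventually)
qed

lemma sum_unit_square: "(\<Sum>p\<in>{0,1::int}\<times>{0,1::int}. f p) = f (0, 0) + f (0, 1) + f (1, 0) + (f (1, 1) :: complex)"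
proof -
  have "{0,1::int} \<times> {0,1::int} = {(0, 0), (0, 1), (1, 0), (1, 1)}" by auto
  thus ?thesis by simp
qed

text \<open>The infimum in the definition of the bound is the gap: the bound on \<open>Re \<epsilon>\<close> says that
  \<open>- Re \<epsilon>\<close> is smaller than this infimum.\<close>

lemma spectral_gap:
  assumes "Re \<epsilon> > qdim_bound pp pm \<epsilon>" "Re \<epsilon> < 0"
  shows "\<exists>\<rho>. \<bar>Re \<epsilon>\<bar> < \<rho> \<and> (\<forall>m. \<not> pp * pm dvd m \<longrightarrow> \<rho> \<le> \<bar>of_int m / alpha_full pp pm - Im \<epsilon>\<bar>)"
proof (intro exI conjI allI impI)
  show "\<bar>Re \<epsilon>\<bar> < Inf (qdim_dists pp pm \<epsilon>)" using assms by (simp add: qdim_bound_def)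
  fix m assume "\<not> pp * pm dvd m"
  hence "\<bar>of_int m / alpha_full pp pm - Im \<epsilon>\<bar> \<in> qdim_dists pp pm \<epsilon>"
    by (auto simp: qdim_dists_def alpha_full_def)
  moreover have "bdd_below (qdim_dists pp pm \<epsilon>)"
    by (rule bdd_belowI[of _ 0]) (auto simp: qdim_dists_def)
  ultimately show "Inf (qdim_dists pp pm \<epsilon>) \<le> \<bar>of_int m / alpha_full pp pm - Im \<epsilon>\<bar>"
    by (rule cInf_lower)
qed

lemma int_multiple_in_Ints:
  fixes pp pm m :: int
  assumes "pp * pm dvd m" "pp \<ge> 2" "pm \<ge> 2"
  shows "of_int m * (of_int i * (of_int r / of_int pp) + of_int j * (of_int s / of_int pm)) \<in> (\<int> :: real set)"
proof -
  obtain l where "m = pp * pm * l" using assms(1) by (elim dvdE)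
  hence "of_int m * (of_int i * (of_int r / of_int pp) + of_int j * (of_int s / of_int pm))
       = (of_int (l * pm * i * r + l * pp * j * s) :: real)"
    using assms by (simp add: field_simps)
  thus ?thesis by (metis Ints_of_int)
qed

section \<open>Limits of the characters and quantum dimensions\<close>

text \<open>The limit of \<open>\<eta> ch[I\<^sub>r\<^sub>,\<^sub>s\<^sub>;\<^sub>n]\<close>, where \<open>w\<close> stands for \<open>\<pi>\<alpha>\<epsilon>\<close>.  The formula covers the border cases as well,
  since the factor for \<open>r = p\<^sub>+\<close> or \<open>s = p\<^sub>-\<close> cancels one factor of the denominator.\<close>

definition eta_ch_limit :: "int \<Rightarrow> int \<Rightarrow> complex \<Rightarrow> int \<Rightarrow> int \<Rightarrow> int \<Rightarrow> complex" where
  "eta_ch_limit pp pm w r s n = exp (w * of_int n) * two_sinh (w * of_int r / of_int pp) * two_sinh (w * of_int s / of_int pm) / (two_sinh w)\<^sup>2"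

context
  fixes pp pm :: int and \<epsilon> w :: complex
  assumes pp: "pp \<ge> 2" and pm: "pm \<ge> 2"
    and bound: "Re \<epsilon> > qdim_bound pp pm \<epsilon>" and \<epsilon>: "Re \<epsilon> \<noteq> 0"
  defines "w \<equiv> of_real pi * \<epsilon> * of_real (alpha_full pp pm)"
begin

lemma Re_w: "Re w \<noteq> 0"
  using \<epsilon> alpha_full_pos[OF pp pm] by (simp add: w_def)

text \<open>With \<open>a = r/p\<^sub>+\<close> and \<open>b = s/p\<^sub>-\<close>, the four families of Fock modules sit at the shifts
  \<open>(n \<plusminus> a \<plusminus> b)/2\<close> with the product of the two signs as coefficient.  The signed sum of exponentials
  therefore factors into two hyperbolic sines.\<close>

lemma ch_irred_interior_limit:
  assumes rs: "r < pp" "s < pm"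
  shows "((\<lambda>y::real. dedekind_eta (\<i> * of_real y) * ch_irred pp pm \<epsilon> r s n (\<i> * of_real y)) \<longlongrightarrow> eta_ch_limit pp pm w r s n) (at_right 0)"
proof -
  let ?\<alpha> = "alpha_full pp pm" and ?\<eta> = "\<lambda>y::real. dedekind_eta (\<i> * of_real y)"
  have \<alpha>: "?\<alpha> > 0" by (rule alpha_full_pos[OF pp pm])
  define a b :: real where "a = of_int r / of_int pp" and "b = of_int s / of_int pm"
  define J where "J = {0,1::int} \<times> {0,1::int}"
  \<comment> \<open>Indexing the signs by 0 and 1 makes differences of shifts integer combinations of a and b.\<close>
  define x where "x = (\<lambda>(i, j). (of_int n + a + b) / 2 - of_int i * a - of_int j * b)"
  define \<kappa> :: "int \<times> int \<Rightarrow> complex" where "\<kappa> = (\<lambda>(i, j). (1 - 2 * of_int i) * (1 - 2 * of_int j))"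
  have J: "finite J" by (simp add: J_def)
  have phase: "of_int m * (x i - x j) \<in> \<int>" if "pp * pm dvd m" for m i j
  proof -
    have "x i - x j = of_int (fst j - fst i) * (of_int r / of_int pp) + of_int (snd j - snd i) * (of_int s / of_int pm)"
      by (simp add: x_def a_def b_def case_prod_unfold algebra_simps)
    thus ?thesis using int_multiple_in_Ints[OF that pp pm] by presburger
  qed
  have \<kappa>0: "(\<Sum>p\<in>J. \<kappa> p) = 0" unfolding J_def sum_unit_square by (simp add: \<kappa>_def)
  have \<kappa>1: "(\<Sum>p\<in>J. \<kappa> p * of_real (x p)) = 0" unfolding J_def sum_unit_square
    by (simp add: \<kappa>_def x_def add_divide_distrib diff_divide_distrib)
  have lim: "((\<lambda>y. \<Sum>p\<in>J. \<kappa> p * half_moment ?\<alpha> \<epsilon> y (x p)) \<longlongrightarrow> (\<Sum>p\<in>J. \<kappa> p * exp (2 * w * of_real (x p))) / (two_sinh w)\<^sup>2) (at_right 0)"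
    unfolding w_def
    by (rule half_sum_combination_limit(2)[OF \<alpha> J \<epsilon> spectral_gap[OF bound] phase \<kappa>0 \<kappa>1])
  have "(\<Sum>p\<in>J. \<kappa> p * exp (2 * w * of_real (x p))) = exp (w * of_int n) * two_sinh (w * of_real a) * two_sinh (w * of_real b)"
  proof -
    have E: "exp (2 * w * of_real (x p)) = exp (w * of_int n) * (exp ((1 - 2 * of_int (fst p)) * (w * of_real a)) * exp ((1 - 2 * of_int (snd p)) * (w * of_real b)))" for p
      unfolding exp_add[symmetric]
      by (rule arg_cong[where f = exp]) (simp add: x_def case_prod_unfold field_simps)
    show ?thesis unfolding J_def sum_unit_square E
      by (simp add: \<kappa>_def two_sinh_def algebra_simps)
  qed
  hence L: "(\<Sum>p\<in>J. \<kappa> p * exp (2 * w * of_real (x p))) / (two_sinh w)\<^sup>2 = eta_ch_limit pp pm w r s n"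
    by (simp add: eta_ch_limit_def a_def b_def)
  define c where "c = (of_int n :: complex) * of_bool (n \<ge> 0)"
  have "((\<lambda>y. c * (of_bool (even n) * (?\<eta> y * ch_minimal pp pm r s (\<i> * of_real y))
              - of_bool (odd n) * (?\<eta> y * ch_minimal pp pm r (pm - s) (\<i> * of_real y)))
           + (\<Sum>p\<in>J. \<kappa> p * half_moment ?\<alpha> \<epsilon> y (x p)))
          \<longlongrightarrow> c * (of_bool (even n) * 0 - of_bool (odd n) * 0) + eta_ch_limit pp pm w r s n) (at_right 0)"
    unfolding L[symmetric]
    by (intro tendsto_add tendsto_mult[of "\<lambda>_. c"] tendsto_diff tendsto_mult[of "\<lambda>_. of_bool _"] tendsto_const ch_minimal_vanishes pp pm lim)
  hence main: "((\<lambda>y. c * (of_bool (even n) * (?\<eta> y * ch_minimal pp pm r s (\<i> * of_real y))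
              - of_bool (odd n) * (?\<eta> y * ch_minimal pp pm r (pm - s) (\<i> * of_real y)))
           + (\<Sum>p\<in>J. \<kappa> p * half_moment ?\<alpha> \<epsilon> y (x p)))
          \<longlongrightarrow> eta_ch_limit pp pm w r s n) (at_right 0)" by simp
  have "eventually (\<lambda>y::real. y > 0) (at_right 0)" by (rule eventually_at_right_less)
  hence "eventually (\<lambda>y. c * (of_bool (even n) * (?\<eta> y * ch_minimal pp pm r s (\<i> * of_real y))
              - of_bool (odd n) * (?\<eta> y * ch_minimal pp pm r (pm - s) (\<i> * of_real y)))
           + (\<Sum>p\<in>J. \<kappa> p * half_moment ?\<alpha> \<epsilon> y (x p))
        = ?\<eta> y * ch_irred pp pm \<epsilon> r s n (\<i> * of_real y)) (at_right 0)"
  proof eventually_elim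
    case (elim y)
    define G where "G p k = gauss \<epsilon> y (of_real (?\<alpha> * (x p - real (Suc k))))" for p k
    have sums: "(\<lambda>k. (\<Sum>p\<in>J. \<kappa> p * (of_nat (Suc k) * G p k)) / ?\<eta> y) sums ((\<Sum>p\<in>J. \<kappa> p * half_moment ?\<alpha> \<epsilon> y (x p)) / ?\<eta> y)"
      unfolding G_def half_moment_def
      by (intro sums_divide sums_sum sums_mult summable_sums half_sum_summable(2)[OF \<alpha> elim])
    have F: "ch_fock_rsn pp pm \<epsilon> r' s' n' (\<i> * of_real y) = G p k / ?\<eta> y"
      if "(of_int n' - of_int r' / of_int pp + of_int s' / of_int pm) / 2 = x p - real (Suc k)" for r' s' n' p k
      unfolding G_def by (rule ch_fock_rsn_imaginary[OF pp pm that])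
    have "(of_nat k + 1) *
            (ch_fock_rsn pp pm \<epsilon> (pp - r) s (n - 2 * int k - 1) (\<i> * of_real y)
             + ch_fock_rsn pp pm \<epsilon> r (pm - s) (n - 2 * int k - 3) (\<i> * of_real y)
             - ch_fock_rsn pp pm \<epsilon> r s (n - 2 * int k - 2) (\<i> * of_real y)
             - ch_fock_rsn pp pm \<epsilon> (pp - r) (pm - s) (n - 2 * int k - 2) (\<i> * of_real y))
        = (\<Sum>p\<in>J. \<kappa> p * (of_nat (Suc k) * G p k)) / ?\<eta> y" for k
    proof -
      have 1: "ch_fock_rsn pp pm \<epsilon> (pp - r) s (n - 2 * int k - 1) (\<i> * of_real y) = G (0, 0) k / ?\<eta> y"
        by (rule F) (use pp pm in \<open>simp add: x_def a_def b_def field_simps\<close>)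
      have 2: "ch_fock_rsn pp pm \<epsilon> r (pm - s) (n - 2 * int k - 3) (\<i> * of_real y) = G (1, 1) k / ?\<eta> y"
        by (rule F) (use pp pm in \<open>simp add: x_def a_def b_def field_simps\<close>)
      have 3: "ch_fock_rsn pp pm \<epsilon> r s (n - 2 * int k - 2) (\<i> * of_real y) = G (1, 0) k / ?\<eta> y"
        by (rule F) (use pp pm in \<open>simp add: x_def a_def b_def field_simps\<close>)
      have 4: "ch_fock_rsn pp pm \<epsilon> (pp - r) (pm - s) (n - 2 * int k - 2) (\<i> * of_real y) = G (0, 1) k / ?\<eta> y"
        by (rule F) (use pp pm in \<open>simp add: x_def a_def b_def field_simps\<close>)
      show ?thesis unfolding 1 2 3 4 J_def sum_unit_square
        by (simp add: \<kappa>_def add_divide_distrib diff_divide_distrib algebra_simps)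
    qed
    with sums have "ch_irred pp pm \<epsilon> r s n (\<i> * of_real y)
       = c * (of_bool (even n) * ch_minimal pp pm r s (\<i> * of_real y) - of_bool (odd n) * ch_minimal pp pm r (pm - s) (\<i> * of_real y))
         + (\<Sum>p\<in>J. \<kappa> p * half_moment ?\<alpha> \<epsilon> y (x p)) / ?\<eta> y"
      using rs by (simp add: ch_irred_def c_def sums_iff)
    moreover have "c * (A * (h * X) - B * (h * Y)) + S = h * (c * (A * X - B * Y) + S / h)"
      if "h \<noteq> 0" for A B X Y S h
      using that by (simp add: distrib_left right_diff_distrib mult_ac)
    ultimately show ?case using dedekind_eta_nonzero[OF elim] by simp
  qed
  with main show ?thesis by (rule Lim_transform_eventually)
qed

text \<open>On the border only the two shifts \<open>(n - 1 \<plusminus> a)/2\<close> occur, with opposite signs and constant weights.\<close>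

lemma border_series_limit:
  fixes F :: "real \<Rightarrow> nat \<Rightarrow> complex"
  assumes F: "\<And>y k. y > 0 \<Longrightarrow> F y k = (gauss \<epsilon> y (of_real (alpha_full pp pm * ((of_int n - 1 + a) / 2 - real k)))
            - gauss \<epsilon> y (of_real (alpha_full pp pm * ((of_int n - 1 + a) / 2 - a - real k)))) / dedekind_eta (\<i> * of_real y)"
    and a: "\<And>m. pp * pm dvd m \<Longrightarrow> of_int m * a \<in> \<int>"
  shows "((\<lambda>y::real. dedekind_eta (\<i> * of_real y) * (\<Sum>k. F y k)) \<longlongrightarrow> exp (w * of_int n) * two_sinh (w * of_real a) / two_sinh w) (at_right 0)"
proof -
  let ?\<alpha> = "alpha_full pp pm" and ?\<eta> = "\<lambda>y::real. dedekind_eta (\<i> * of_real y)"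
  have \<alpha>: "?\<alpha> > 0" by (rule alpha_full_pos[OF pp pm])
  define x where "x j = (of_int n - 1 + a) / 2 - of_int j * a" for j :: int
  define \<kappa> :: "int \<Rightarrow> complex" where "\<kappa> j = 1 - 2 * of_int j" for j
  have phase: "of_int m * (x i - x j) \<in> \<int>" if "pp * pm dvd m" for m i j
  proof -
    have "of_int m * (x i - x j) = of_int (j - i) * (of_int m * a)" by (simp add: x_def algebra_simps)
    thus ?thesis using a[OF that] by (metis Ints_mult Ints_of_int)
  qed
  have \<kappa>0: "(\<Sum>j\<in>{0,1}. \<kappa> j) = 0" by (simp add: \<kappa>_def)
  have lim: "((\<lambda>y. \<Sum>j\<in>{0,1}. \<kappa> j * half_sum ?\<alpha> \<epsilon> y (x j)) \<longlongrightarrow> (\<Sum>j\<in>{0,1}. \<kappa> j * exp (2 * w * of_real (x j))) * exp w / two_sinh w) (at_right 0)"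
    unfolding w_def
    by (rule half_sum_combination_limit(1)[OF \<alpha> _ \<epsilon> spectral_gap[OF bound] phase \<kappa>0]) simp_all
  have E: "exp (2 * w * of_real (x j)) * exp w = exp (w * of_int n) * exp ((1 - 2 * of_int j) * (w * of_real a))" for j
    unfolding exp_add[symmetric]
    by (rule arg_cong[where f = exp]) (simp add: x_def field_simps)
  have "(\<Sum>j\<in>{0,1}. \<kappa> j * exp (2 * w * of_real (x j))) * exp w = exp (w * of_int n) * two_sinh (w * of_real a)"
  proof -
    have "(\<Sum>j\<in>{0,1}. \<kappa> j * exp (2 * w * of_real (x j))) * exp w = (\<Sum>j\<in>{0,1}. \<kappa> j * (exp (2 * w * of_real (x j)) * exp w))"
      by (simp only: sum_distrib_right mult.assoc)
    thus ?thesis unfolding E by (simp add: \<kappa>_def two_sinh_def algebra_simps)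
  qed
  with lim have main: "((\<lambda>y. half_sum ?\<alpha> \<epsilon> y (x 0) - half_sum ?\<alpha> \<epsilon> y (x 1)) \<longlongrightarrow> exp (w * of_int n) * two_sinh (w * of_real a) / two_sinh w) (at_right 0)"
    by (simp add: \<kappa>_def)
  have "eventually (\<lambda>y::real. y > 0) (at_right 0)" by (rule eventually_at_right_less)
  hence "eventually (\<lambda>y. half_sum ?\<alpha> \<epsilon> y (x 0) - half_sum ?\<alpha> \<epsilon> y (x 1) = ?\<eta> y * (\<Sum>k. F y k)) (at_right 0)"
  proof eventually_elim
    case (elim y)
    have "(\<lambda>k. (gauss \<epsilon> y (of_real (?\<alpha> * (x 0 - real k))) - gauss \<epsilon> y (of_real (?\<alpha> * (x 1 - real k)))) / ?\<eta> y)
       sums ((half_sum ?\<alpha> \<epsilon> y (x 0) - half_sum ?\<alpha> \<epsilon> y (x 1)) / ?\<eta> y)"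
      unfolding half_sum_def
      by (intro sums_divide sums_diff summable_sums half_sum_summable(1)[OF \<alpha> elim])
    hence "(\<Sum>k. F y k) = (half_sum ?\<alpha> \<epsilon> y (x 0) - half_sum ?\<alpha> \<epsilon> y (x 1)) / ?\<eta> y"
      unfolding F[OF elim] by (simp add: x_def sums_iff)
    thus ?case using dedekind_eta_nonzero[OF elim] by simp
  qed
  with main show ?thesis by (rule Lim_transform_eventually)
qed

lemma Ints_multiples:
  assumes "pp * pm dvd m"
  shows "of_int m * (of_int r / of_int pp) \<in> (\<int> :: real set)" "of_int m * (of_int s / of_int pm) \<in> (\<int> :: real set)"
  using int_multiple_in_Ints[OF assms pp pm, of 1 r 0 0] int_multiple_in_Ints[OF assms pp pm, of 0 0 1 s] by simp_all

lemma ch_irred_limit: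
  assumes rs: "1 \<le> r" "r \<le> pp" "1 \<le> s" "s \<le> pm"
  shows "((\<lambda>y::real. dedekind_eta (\<i> * of_real y) * ch_irred pp pm \<epsilon> r s n (\<i> * of_real y)) \<longlongrightarrow> eta_ch_limit pp pm w r s n) (at_right 0)"
proof -
  have w: "two_sinh w \<noteq> 0" by (rule two_sinh_nonzero[OF Re_w])
  have p0: "(of_int pp :: real) \<noteq> 0" "(of_int pm :: real) \<noteq> 0" "(of_int pp :: complex) \<noteq> 0" "(of_int pm :: complex) \<noteq> 0" using pp pm by auto
  consider "r < pp" "s < pm" | "r < pp" "s = pm" | "r = pp" "s < pm" | "r = pp" "s = pm"
    using rs by linarith
  thus ?thesis
  proof cases
    case 1
    thus ?thesis by (rule ch_irred_interior_limit)
  next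
    case 2
    have "((\<lambda>y::real. dedekind_eta (\<i> * of_real y) * (\<Sum>k. ch_fock_rsn pp pm \<epsilon> (pp - r) pm (n - 2 * int k - 1) (\<i> * of_real y)
                  - ch_fock_rsn pp pm \<epsilon> r pm (n - 2 * int k - 2) (\<i> * of_real y)))
        \<longlongrightarrow> exp (w * of_int n) * two_sinh (w * of_real (of_int r / of_int pp)) / two_sinh w) (at_right 0)"
    proof (rule border_series_limit)
      fix y :: real and k :: nat assume "y > 0"
      show "ch_fock_rsn pp pm \<epsilon> (pp - r) pm (n - 2 * int k - 1) (\<i> * of_real y) - ch_fock_rsn pp pm \<epsilon> r pm (n - 2 * int k - 2) (\<i> * of_real y)
         = (gauss \<epsilon> y (of_real (alpha_full pp pm * ((of_int n - 1 + of_int r / of_int pp) / 2 - real k)))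
            - gauss \<epsilon> y (of_real (alpha_full pp pm * ((of_int n - 1 + of_int r / of_int pp) / 2 - of_int r / of_int pp - real k)))) / dedekind_eta (\<i> * of_real y)"
        unfolding diff_divide_distrib
        by (intro arg_cong2[where f = "(-)"] ch_fock_rsn_imaginary pp pm) (use p0 in \<open>simp_all add: field_simps\<close>)
    qed (rule Ints_multiples)
    thus ?thesis using 2 w p0 by (simp add: ch_irred_def eta_ch_limit_def power2_eq_square)
  next
    case 3
    have "((\<lambda>y::real. dedekind_eta (\<i> * of_real y) * (\<Sum>k. ch_fock_rsn pp pm \<epsilon> pp s (n - 2 * int k) (\<i> * of_real y)
                  - ch_fock_rsn pp pm \<epsilon> pp (pm - s) (n - 2 * int k - 1) (\<i> * of_real y)))
        \<longlongrightarrow> exp (w * of_int n) * two_sinh (w * of_real (of_int s / of_int pm)) / two_sinh w) (at_right 0)"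
    proof (rule border_series_limit)
      fix y :: real and k :: nat assume "y > 0"
      show "ch_fock_rsn pp pm \<epsilon> pp s (n - 2 * int k) (\<i> * of_real y) - ch_fock_rsn pp pm \<epsilon> pp (pm - s) (n - 2 * int k - 1) (\<i> * of_real y)
         = (gauss \<epsilon> y (of_real (alpha_full pp pm * ((of_int n - 1 + of_int s / of_int pm) / 2 - real k)))
            - gauss \<epsilon> y (of_real (alpha_full pp pm * ((of_int n - 1 + of_int s / of_int pm) / 2 - of_int s / of_int pm - real k)))) / dedekind_eta (\<i> * of_real y)"
        unfolding diff_divide_distrib
        by (intro arg_cong2[where f = "(-)"] ch_fock_rsn_imaginary pp pm) (use p0 in \<open>simp_all add: field_simps\<close>)
    qed (rule Ints_multiples)
    thus ?thesis using 3 w p0 by (simp add: ch_irred_def eta_ch_limit_def power2_eq_square)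
  next
    case 4
    have "((\<lambda>y. exp (2 * of_real pi * \<epsilon> * of_real (alpha_full pp pm * (of_int n / 2)) - of_real (pi * y) * (of_real (alpha_full pp pm * (of_int n / 2)))\<^sup>2))
      \<longlongrightarrow> exp (2 * of_real pi * \<epsilon> * of_real (alpha_full pp pm * (of_int n / 2)) - of_real (pi * 0) * (of_real (alpha_full pp pm * (of_int n / 2)))\<^sup>2)) (at_right 0)"
      by (intro tendsto_intros)
    hence lim: "((\<lambda>y. gauss \<epsilon> y (of_real (alpha_full pp pm * (of_int n / 2)))) \<longlongrightarrow> exp (w * of_int n)) (at_right 0)"
      by (simp add: gauss_def w_def mult_ac)
    have "eventually (\<lambda>y::real. y > 0) (at_right 0)" by (rule eventually_at_right_less)
    hence "eventually (\<lambda>y. gauss \<epsilon> y (of_real (alpha_full pp pm * (of_int n / 2)))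
        = dedekind_eta (\<i> * of_real y) * ch_irred pp pm \<epsilon> r s n (\<i> * of_real y)) (at_right 0)"
    proof eventually_elim
      case (elim y)
      have "ch_fock_rsn pp pm \<epsilon> pp pm n (\<i> * of_real y) = gauss \<epsilon> y (of_real (alpha_full pp pm * (of_int n / 2))) / dedekind_eta (\<i> * of_real y)"
        by (rule ch_fock_rsn_imaginary[OF pp pm]) (use p0 in simp)
      thus ?case using 4 dedekind_eta_nonzero[OF elim] by (simp add: ch_irred_def)
    qed
    with lim have "((\<lambda>y. dedekind_eta (\<i> * of_real y) * ch_irred pp pm \<epsilon> r s n (\<i> * of_real y)) \<longlongrightarrow> exp (w * of_int n)) (at_right 0)"
      by (rule Lim_transform_eventually)
    thus ?thesis using 4 w p0 by (simp add: eta_ch_limit_def power2_eq_square)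
  qed
qed

lemma ch_fock_limit:
  "((\<lambda>y::real. dedekind_eta (\<i> * of_real y) * ch_fock pp pm \<epsilon> (lam + of_real (alpha_zero pp pm) / 2) (\<i> * of_real y))
     \<longlongrightarrow> exp (2 * of_real pi * lam * \<epsilon>)) (at_right 0)"
proof -
  have "((\<lambda>y. exp (2 * of_real pi * \<epsilon> * lam - of_real (pi * y) * lam\<^sup>2)) \<longlongrightarrow> exp (2 * of_real pi * \<epsilon> * lam - of_real (pi * 0) * lam\<^sup>2)) (at_right 0)"
    by (intro tendsto_intros)
  hence lim: "((\<lambda>y. gauss \<epsilon> y lam) \<longlongrightarrow> exp (2 * of_real pi * lam * \<epsilon>)) (at_right 0)"
    by (simp add: gauss_def mult_ac)
  have "eventually (\<lambda>y::real. y > 0) (at_right 0)" by (rule eventually_at_right_less)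
  hence "eventually (\<lambda>y. gauss \<epsilon> y lam = dedekind_eta (\<i> * of_real y) * ch_fock pp pm \<epsilon> (lam + of_real (alpha_zero pp pm) / 2) (\<i> * of_real y)) (at_right 0)"
    by eventually_elim (simp add: ch_fock_imaginary dedekind_eta_nonzero)
  with lim show ?thesis by (rule Lim_transform_eventually)
qed

lemma ch_vacuum_limit:
  "((\<lambda>y::real. dedekind_eta (\<i> * of_real y) * ch_vacuum pp pm \<epsilon> (\<i> * of_real y)) \<longlongrightarrow> eta_ch_limit pp pm w 1 1 0) (at_right 0)"
proof -
  have "((\<lambda>y::real. dedekind_eta (\<i> * of_real y) * ch_minimal pp pm 1 1 (\<i> * of_real y)
       + dedekind_eta (\<i> * of_real y) * ch_irred pp pm \<epsilon> 1 1 0 (\<i> * of_real y)) \<longlongrightarrow> 0 + eta_ch_limit pp pm w 1 1 0) (at_right 0)"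
    by (intro tendsto_add ch_minimal_vanishes ch_irred_limit pp pm) (use pp pm in auto)
  thus ?thesis by (simp add: ch_vacuum_def distrib_left)
qed

lemma two_sinh_fraction_nonzero: "two_sinh (w / of_int pp) \<noteq> 0" "two_sinh (w / of_int pm) \<noteq> 0"
proof -
  have "Re (w / of_int k) \<noteq> 0" if "k \<ge> 2" for k :: int
  proof -
    have "Re (w / of_int k) = Re w / of_int k"
      using Re_divide_of_real[of w "of_int k"] by simp
    thus ?thesis using Re_w that by simp
  qed
  thus "two_sinh (w / of_int pp) \<noteq> 0" "two_sinh (w / of_int pm) \<noteq> 0" using pp pm two_sinh_nonzero by blast+
qed

text \<open>The eta function cancels in the quotient, and the limit for the vacuum module is nonzero
  because \<open>Re \<epsilon> \<noteq> 0\<close>.\<close>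

lemma has_qdim_from_limit:
  assumes "((\<lambda>y::real. dedekind_eta (\<i> * of_real y) * ch (\<i> * of_real y)) \<longlongrightarrow> l) (at_right 0)"
  shows "has_qdim pp pm \<epsilon> ch (l / eta_ch_limit pp pm w 1 1 0)"
proof -
  have nz: "eta_ch_limit pp pm w 1 1 0 \<noteq> 0"
    using two_sinh_fraction_nonzero two_sinh_nonzero[OF Re_w] by (simp add: eta_ch_limit_def)
  have lim: "((\<lambda>y::real. (dedekind_eta (\<i> * of_real y) * ch (\<i> * of_real y)) / (dedekind_eta (\<i> * of_real y) * ch_vacuum pp pm \<epsilon> (\<i> * of_real y)))
      \<longlongrightarrow> l / eta_ch_limit pp pm w 1 1 0) (at_right 0)"
    by (intro tendsto_divide assms ch_vacuum_limit nz)
  have "eventually (\<lambda>y::real. y > 0) (at_right 0)" by (rule eventually_at_right_less)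
  hence "eventually (\<lambda>y::real. (dedekind_eta (\<i> * of_real y) * ch (\<i> * of_real y)) / (dedekind_eta (\<i> * of_real y) * ch_vacuum pp pm \<epsilon> (\<i> * of_real y))
      = ch (\<i> * of_real y) / ch_vacuum pp pm \<epsilon> (\<i> * of_real y)) (at_right 0)"
    by eventually_elim (simp add: dedekind_eta_nonzero)
  with lim show ?thesis unfolding has_qdim_def by (rule Lim_transform_eventually)
qed

end

theorem proposition16:
  fixes pp pm :: int and \<epsilon> :: complex
  assumes "pp \<ge> 2" and "pm \<ge> 2" and "coprime pp pm"
    and "Re \<epsilon> > qdim_bound pp pm \<epsilon>" and "Re \<epsilon> \<noteq> 0"
  shows "(\<forall>lam::complex.
           has_qdim pp pm \<epsilon> (ch_fock pp pm \<epsilon> (lam + of_real (alpha_zero pp pm) / 2))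
             (exp (2 * of_real pi * lam * \<epsilon>)
                * (sin (\<i> * of_real pi * of_real (sqrt (2 * of_int pp * of_int pm)) * \<epsilon>)
                   * sin (\<i> * of_real pi * of_real (sqrt (2 * of_int pp * of_int pm)) * \<epsilon>))
                / (sin (\<i> * of_real pi * of_real (sqrt (2 * of_int pp / of_int pm)) * \<epsilon>)
                   * sin (\<i> * of_real pi * of_real (sqrt (2 * of_int pm / of_int pp)) * \<epsilon>))))
       \<and> (\<forall>r s n :: int. 1 \<le> r \<and> r \<le> pp \<and> 1 \<le> s \<and> s \<le> pm \<longrightarrow>
           has_qdim pp pm \<epsilon> (ch_irred pp pm \<epsilon> r s n)
             (exp (of_real (sqrt (2 * of_int pp * of_int pm)) * of_real pi * of_int n * \<epsilon>)
                * (sin (\<i> * of_int r * of_real pi * of_real (sqrt (2 * of_int pm / of_int pp)) * \<epsilon>)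
                   * sin (\<i> * of_int s * of_real pi * of_real (sqrt (2 * of_int pp / of_int pm)) * \<epsilon>))
                / (sin (\<i> * of_real pi * of_real (sqrt (2 * of_int pm / of_int pp)) * \<epsilon>)
                   * sin (\<i> * of_real pi * of_real (sqrt (2 * of_int pp / of_int pm)) * \<epsilon>))))"
proof -
  define w where "w = of_real pi * \<epsilon> * of_real (alpha_full pp pm)"
  note * = assms(1,2,4,5)
  note nz = two_sinh_fraction_nonzero[OF *, folded w_def] two_sinh_nonzero[OF Re_w[OF *], folded w_def]
  have "\<i> * of_real pi * of_real (sqrt (2 * of_int pp * of_int pm)) * \<epsilon> = \<i> * w"
    by (simp add: w_def alpha_full_def mult_ac)
  hence full: "sin (\<i> * of_real pi * of_real (sqrt (2 * of_int pp * of_int pm)) * \<epsilon>) = \<i> / 2 * two_sinh w"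
    by (simp only: sin_times_i)
  have full': "exp (of_real (sqrt (2 * of_int pp * of_int pm)) * of_real pi * of_int n * \<epsilon>) = exp (w * of_int n)" for n
    by (simp add: w_def alpha_full_def mult_ac)
  have "\<i> * of_int r * of_real pi * of_real (sqrt (2 * of_int pm / of_int pp)) * \<epsilon> = \<i> * (w * of_int r / of_int pp)"
    "\<i> * of_int r * of_real pi * of_real (sqrt (2 * of_int pp / of_int pm)) * \<epsilon> = \<i> * (w * of_int r / of_int pm)" for r
    unfolding sqrt_quotient_eq_alpha_full[OF assms(1,2)] by (simp_all add: w_def mult_ac)
  hence frac: "sin (\<i> * of_int r * of_real pi * of_real (sqrt (2 * of_int pm / of_int pp)) * \<epsilon>) = \<i> / 2 * two_sinh (w * of_int r / of_int pp)"
    "sin (\<i> * of_int r * of_real pi * of_real (sqrt (2 * of_int pp / of_int pm)) * \<epsilon>) = \<i> / 2 * two_sinh (w * of_int r / of_int pm)" for r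
    by (simp_all only: sin_times_i)
  have frac1: "sin (\<i> * of_real pi * of_real (sqrt (2 * of_int pm / of_int pp)) * \<epsilon>) = \<i> / 2 * two_sinh (w / of_int pp)"
    "sin (\<i> * of_real pi * of_real (sqrt (2 * of_int pp / of_int pm)) * \<epsilon>) = \<i> / 2 * two_sinh (w / of_int pm)"
    using frac[of 1] by simp_all
  note q = has_qdim_from_limit[OF *, folded w_def]
  show ?thesis unfolding full full' frac frac1
  proof (intro conjI allI impI)
    fix lam :: complex
    show "has_qdim pp pm \<epsilon> (ch_fock pp pm \<epsilon> (lam + of_real (alpha_zero pp pm) / 2))
      (exp (2 * of_real pi * lam * \<epsilon>) * (\<i> / 2 * two_sinh w * (\<i> / 2 * two_sinh w)) / (\<i> / 2 * two_sinh (w / of_int pm) * (\<i> / 2 * two_sinh (w / of_int pp))))"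
      using q[OF ch_fock_limit[OF *, of lam]] nz by (simp add: eta_ch_limit_def power2_eq_square mult_ac)
  next
    fix r s n :: int assume rs: "1 \<le> r \<and> r \<le> pp \<and> 1 \<le> s \<and> s \<le> pm"
    show "has_qdim pp pm \<epsilon> (ch_irred pp pm \<epsilon> r s n)
      (exp (w * of_int n) * (\<i> / 2 * two_sinh (w * of_int r / of_int pp) * (\<i> / 2 * two_sinh (w * of_int s / of_int pm)))
       / (\<i> / 2 * two_sinh (w / of_int pp) * (\<i> / 2 * two_sinh (w / of_int pm))))"
      using q[OF ch_irred_limit[OF *, of r s n, folded w_def]] rs nz by (simp add: eta_ch_limit_def power2_eq_square mult_ac)
  qed
qed

end
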